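(* Let $E$ be a Banach lattice and let $A\subseteq E$ be a norm bounded d-compact set. Then $\chi(A)=\rho(A)$.
   Context: Banach lattices are complex unless specified otherwise. $E_+$ is the positive cone, $B_E$ the unit ball, and for $u\in E_+$, $[-u,u]=\{x\in E:|x|\le u\}$. A net $(x_\alpha)$ in $E$ d-converges to $x\in E$ if $\||x_\alpha-x|\wedge y\|\to0$ for every $y\in E_+$. The topology generated by this convergence is the d-topology of $E$ (a base of neighbourhoods of $0$ is given by finite intersections of the sets $\{x\in E:\||x|\wedge y\|<\varepsilon\}$, $y\in E_+$, $\varepsilon>0$). A set is d-compact if it is compact with respect to the d-topology. For a bounded set $A\subseteq E$: $\chi(A)=\inf\{\delta>0 : A \text{ can be covered by finitely many balls of radius }\delta\}$ and $\rho(A)=\inf\{\delta>0 : A\subseteq[-u,u]+\delta B_E\text{ for some }u\in E_+\}$. *)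

theory Defs
  imports "HOL-Analysis.Analysis" "HOL-Library.Lattice_Algebras"
begin

section \<open>Real Banach lattices\<close>

class real_banach_lattice = banach + ordered_real_vector + lattice_ab_group_add_abs +
  assumes norm_mono_abs: "\<bar>x\<bar> \<le> \<bar>y\<bar> \<Longrightarrow> norm x \<le> norm y"

lemma norm_mono_nonneg: "0 \<le> x \<Longrightarrow> x \<le> y \<Longrightarrow> norm x \<le> norm y"
  for x y :: "'a::real_banach_lattice"
  by (rule norm_mono_abs) (metis abs_of_nonneg order_trans)

lemma norm_abs_eq: "norm \<bar>x\<bar> = norm x"
  for x :: "'a::real_banach_lattice"
  by (intro order.antisym norm_mono_abs) simp_all

lemma scaleR_le_scaleR_abs: "r *\<^sub>R x \<le> \<bar>r\<bar> *\<^sub>R \<bar>x\<bar>"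
  for x :: "'a::real_banach_lattice"
proof (cases "0 \<le> r")
  case True
  then show ?thesis by (simp add: scaleR_left_mono abs_ge_self)
next
  case False
  then have "(- r) *\<^sub>R (- x) \<le> (- r) *\<^sub>R \<bar>x\<bar>"
    by (intro scaleR_left_mono) (auto simp: abs_ge_minus_self)
  then show ?thesis using False by simp
qed

lemma tendsto_nonneg_cone:
  fixes f :: "nat \<Rightarrow> 'a::real_banach_lattice"
  assumes f: "f \<longlonglongrightarrow> a" and nn: "\<And>n. 0 \<le> f n"
  shows "0 \<le> a"
proof -
  have bound: "norm (sup (- a) 0) \<le> norm (f n - a)" for n
  proof -
    have "- a \<le> f n - a" using nn[of n] by simp
    also have "\<dots> \<le> \<bar>f n - a\<bar>" by (rule abs_ge_self)
    finally have "sup (- a) 0 \<le> \<bar>f n - a\<bar>" by simp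
    moreover have "0 \<le> sup (- a) 0" by simp
    ultimately show ?thesis using norm_mono_nonneg norm_abs_eq by metis
  qed
  have "(\<lambda>n. norm (f n - a)) \<longlonglongrightarrow> 0" using f by (simp add: LIM_zero_iff tendsto_norm_zero)
  then have "norm (sup (- a) 0) \<le> 0"
    by (rule LIMSEQ_le_const) (use bound in auto)
  then have "sup (- a) 0 = 0" by simp
  then show ?thesis by (metis neg_le_0_iff_le sup.cobounded1)
qed

lemma tendsto_mono_cone:
  fixes f :: "nat \<Rightarrow> 'a::real_banach_lattice"
  assumes "f \<longlonglongrightarrow> a" "g \<longlonglongrightarrow> b" "\<And>n. f n \<le> g n"
  shows "a \<le> b"
proof -
  have "(\<lambda>n. g n - f n) \<longlonglongrightarrow> b - a" by (intro tendsto_diff assms)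
  then have "0 \<le> b - a" by (rule tendsto_nonneg_cone) (simp add: assms)
  then show ?thesis by simp
qed

section \<open>Complex Banach lattices as complexifications of real ones\<close>

datatype 'a complexification = Cplx (rpart: 'a) (ipart: 'a)

lemma complexification_eq_iff: "z = w \<longleftrightarrow> rpart z = rpart w \<and> ipart z = ipart w"
  by (cases z; cases w) simp

instantiation complexification :: (real_vector) real_vector
begin

definition "0 = Cplx 0 0"
definition "z + w = Cplx (rpart z + rpart w) (ipart z + ipart w)"
definition "z - w = Cplx (rpart z - rpart w) (ipart z - ipart w)"
definition "- z = Cplx (- rpart z) (- ipart z)"
definition "r *\<^sub>R z = Cplx (r *\<^sub>R rpart z) (r *\<^sub>R ipart z)"

instance
  by standard (simp_all add: complexification_eq_iff zero_complexification_def
    plus_complexification_def minus_complexification_def uminus_complexification_def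
    scaleR_complexification_def algebra_simps)

end

lemma parts_simps [simp]:
  "rpart 0 = 0" "ipart 0 = 0"
  "rpart (z + w) = rpart z + rpart w" "ipart (z + w) = ipart z + ipart w"
  "rpart (z - w) = rpart z - rpart w" "ipart (z - w) = ipart z - ipart w"
  "rpart (- z) = - rpart z" "ipart (- z) = - ipart z"
  "rpart (r *\<^sub>R z) = r *\<^sub>R rpart z" "ipart (r *\<^sub>R z) = r *\<^sub>R ipart z"
  by (simp_all add: zero_complexification_def
    plus_complexification_def minus_complexification_def uminus_complexification_def
    scaleR_complexification_def)

definition cscale :: "complex \<Rightarrow> 'a::real_vector complexification \<Rightarrow> 'a complexification" where
  "cscale c z = Cplx (Re c *\<^sub>R rpart z - Im c *\<^sub>R ipart z) (Re c *\<^sub>R ipart z + Im c *\<^sub>R rpart z)"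

lemma vector_space_cscale: "vector_space cscale"
  by standard (simp_all add: complexification_eq_iff cscale_def algebra_simps)

lemma cscale_of_real: "cscale (complex_of_real r) z = r *\<^sub>R z"
  by (simp add: complexification_eq_iff cscale_def)

text \<open>
  \<open>|z| = sup {Re (e\<^bsup>i\<theta>\<^esup> z) | \<theta> real}\<close>; the supremum exists because of the completeness of the
  norm, see \<open>modulus_least_upper_bound\<close> below.
\<close>

definition modulus :: "'a::real_banach_lattice complexification \<Rightarrow> 'a" where
  "modulus z = (LEAST m. \<forall>\<theta>. rpart (cscale (cis \<theta>) z) \<le> m)"

lemma rotation_lipschitz:
  fixes z :: "'a::real_banach_lattice complexification"
  shows "rpart (cscale (cis s) z)
    \<le> rpart (cscale (cis t) z) + \<bar>s - t\<bar> *\<^sub>R (\<bar>rpart z\<bar> + \<bar>ipart z\<bar>)"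
proof -
  have *: "r *\<^sub>R x \<le> \<bar>s - t\<bar> *\<^sub>R \<bar>x\<bar>" if "\<bar>r\<bar> \<le> \<bar>s - t\<bar>" for r and x :: 'a
  proof -
    have "r *\<^sub>R x \<le> \<bar>r\<bar> *\<^sub>R \<bar>x\<bar>" by (rule scaleR_le_scaleR_abs)
    also have "\<dots> \<le> \<bar>s - t\<bar> *\<^sub>R \<bar>x\<bar>" using that by (intro scaleR_right_mono) auto
    finally show ?thesis .
  qed
  have lip: "dist (cis s) (cis t) \<le> \<bar>s - t\<bar>"
  proof -
    have "cis s - cis t = cis t * (cis (s - t) - 1)"
      by (simp add: algebra_simps cis_mult)
    then have "dist (cis s) (cis t) = cmod (cis (s - t) - 1)"
      by (simp add: dist_norm norm_mult)
    also have "\<dots> = 2 * \<bar>sin ((s - t) / 2)\<bar>"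
      by (metis cis_conv_exp dist_exp_i_1 dist_norm)
    also have "\<dots> \<le> \<bar>s - t\<bar>" using abs_sin_x_le_abs_x[of "(s - t) / 2"] by simp
    finally show ?thesis .
  qed
  have "\<bar>cos s - cos t\<bar> \<le> \<bar>s - t\<bar>"
    using abs_Re_le_cmod[of "cis s - cis t"] lip by (simp add: dist_norm)
  note c = *[OF this, of "rpart z"]
  have "\<bar>sin t - sin s\<bar> \<le> \<bar>s - t\<bar>"
    using abs_Im_le_cmod[of "cis s - cis t"] lip by (simp add: dist_norm)
  note s = *[OF this, of "ipart z"]
  have "rpart (cscale (cis s) z) - rpart (cscale (cis t) z)
      = (cos s - cos t) *\<^sub>R rpart z + (sin t - sin s) *\<^sub>R ipart z"
    by (simp add: cscale_def algebra_simps)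
  also have "\<dots> \<le> \<bar>s - t\<bar> *\<^sub>R \<bar>rpart z\<bar> + \<bar>s - t\<bar> *\<^sub>R \<bar>ipart z\<bar>"
    using c s by (rule add_mono)
  finally show ?thesis by (simp add: algebra_simps)
qed

lemma modulus_exists:
  fixes z :: "'a::real_banach_lattice complexification"
  shows "\<exists>m. (\<forall>\<theta>. rpart (cscale (cis \<theta>) z) \<le> m) \<and>
    (\<forall>w. (\<forall>\<theta>. rpart (cscale (cis \<theta>) z) \<le> w) \<longrightarrow> m \<le> w)"
proof -
  define f where "f = (\<lambda>\<theta>. rpart (cscale (cis \<theta>) z))"
  define v where "v = \<bar>rpart z\<bar> + \<bar>ipart z\<bar>"
  define c where "c = (\<lambda>n::nat. 2 * pi / real (Suc n))"
  define S where "S = (\<lambda>n. Sup_fin ((\<lambda>k::nat. f (real k * c n)) ` {..Suc n}))"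
  have v0: "0 \<le> v" by (simp add: v_def)
  have approx: "f \<theta> \<le> S n + c n *\<^sub>R v" for \<theta> n
  proof -
    have cpos: "c n > 0" by (simp add: c_def)
    define \<phi> where "\<phi> = \<theta> - 2 * pi * of_int \<lfloor>\<theta> / (2 * pi)\<rfloor>"
    have fr: "\<phi> = 2 * pi * frac (\<theta> / (2 * pi))"
      by (simp add: \<phi>_def frac_def algebra_simps)
    have \<phi>: "0 \<le> \<phi>" "\<phi> < 2 * pi"
      using frac_ge_0[of "\<theta> / (2 * pi)"] frac_lt_1[of "\<theta> / (2 * pi)"] pi_gt_zero
      unfolding fr by (auto simp: mult_less_cancel_left1)
    have "cis \<theta> = cis (\<phi> + 2 * pi * of_int \<lfloor>\<theta> / (2 * pi)\<rfloor>)" by (simp add: \<phi>_def)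
    also have "\<dots> = cis \<phi>" by (simp add: cis_mult[symmetric] cis_multiple_2pi)
    finally have f\<phi>: "f \<theta> = f \<phi>" by (simp add: f_def)
    define k where "k = nat \<lfloor>\<phi> / c n\<rfloor>"
    have k1: "real k \<le> \<phi> / c n" "\<phi> / c n < real k + 1"
      using \<phi> cpos by (auto simp: k_def)
    have "real k \<le> real (Suc n)"
    proof -
      have "\<phi> / c n \<le> 2 * pi / c n" using \<phi> cpos by (intro divide_right_mono) auto
      also have "\<dots> = real (Suc n)" by (simp add: c_def)
      finally show ?thesis using k1 by simp
    qed
    then have k2: "k \<le> Suc n" by simp
    have close: "\<bar>\<phi> - real k * c n\<bar> \<le> c n"
    proof -
      have "real k * c n \<le> \<phi>" using k1(1) cpos by (simp add: pos_le_divide_eq)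
      moreover have "\<phi> < (real k + 1) * c n" using k1(2) cpos by (simp add: pos_divide_less_eq)
      ultimately show ?thesis by (simp add: algebra_simps)
    qed
    have "f \<phi> \<le> f (real k * c n) + \<bar>\<phi> - real k * c n\<bar> *\<^sub>R v"
      unfolding f_def v_def by (rule rotation_lipschitz)
    also have "\<dots> \<le> S n + c n *\<^sub>R v"
    proof (rule add_mono)
      show "f (real k * c n) \<le> S n"
        unfolding S_def by (rule Sup_fin.coboundedI) (use k2 in auto)
      show "\<bar>\<phi> - real k * c n\<bar> *\<^sub>R v \<le> c n *\<^sub>R v"
        using close v0 by (rule scaleR_right_mono)
    qed
    finally show ?thesis using f\<phi> by simp
  qed
  have S_le: "S n \<le> w" if "\<And>\<theta>. f \<theta> \<le> w" for n w
    unfolding S_def by (rule Sup_fin.boundedI) (use that in auto)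
  have S_diff: "S n \<le> S m + c m *\<^sub>R v" for n m
    by (rule S_le) (rule approx)
  have S_norm: "norm (S n - S m) \<le> (c n + c m) * norm v" for n m
  proof -
    have cc: "0 \<le> c n" "0 \<le> c m" by (simp_all add: c_def)
    have "S n - S m \<le> c m *\<^sub>R v" using S_diff[of n m] by (simp add: algebra_simps)
    also have "\<dots> \<le> (c n + c m) *\<^sub>R v" using cc v0 by (intro scaleR_right_mono) auto
    finally have 1: "S n - S m \<le> (c n + c m) *\<^sub>R v" .
    have "- (S n - S m) \<le> c n *\<^sub>R v" using S_diff[of m n] by (simp add: algebra_simps)
    also have "\<dots> \<le> (c n + c m) *\<^sub>R v" using cc v0 by (intro scaleR_right_mono) auto
    finally have 2: "- (S n - S m) \<le> (c n + c m) *\<^sub>R v" .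
    have "\<bar>S n - S m\<bar> \<le> (c n + c m) *\<^sub>R v" using 1 2 by (rule abs_leI)
    also have "\<dots> \<le> \<bar>(c n + c m) *\<^sub>R v\<bar>" by (rule abs_ge_self)
    finally have "norm (S n - S m) \<le> norm ((c n + c m) *\<^sub>R v)" by (rule norm_mono_abs)
    then show ?thesis using cc by simp
  qed
  have c0: "c \<longlonglongrightarrow> 0" 
    using tendsto_mult_right_zero[OF LIMSEQ_inverse_real_of_nat, of "2 * pi"]
    by (simp add: c_def divide_inverse)
  have "Cauchy S"
  proof (rule CauchyI)
    fix e :: real assume e: "0 < e"
    have "(\<lambda>n. c n * norm v) \<longlonglongrightarrow> 0 * norm v" by (intro tendsto_intros c0)
    then have "\<forall>\<^sub>F n in sequentially. c n * norm v < e / 2"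
      using e by (intro order_tendstoD) auto
    then obtain N where N: "\<And>n. n \<ge> N \<Longrightarrow> c n * norm v < e / 2"
      by (auto simp: eventually_sequentially)
    show "\<exists>M. \<forall>m\<ge>M. \<forall>n\<ge>M. norm (S m - S n) < e"
    proof (intro exI allI impI)
      fix m n assume "N \<le> m" "N \<le> n"
      then have "(c m + c n) * norm v < e" using N[of m] N[of n] by (simp add: algebra_simps)
      then show "norm (S m - S n) < e" using S_norm[of m n] by simp
    qed
  qed
  then obtain s where s: "S \<longlonglongrightarrow> s" by (auto simp: Cauchy_convergent_iff convergent_def)
  have "f \<theta> \<le> s" for \<theta>
  proof (rule tendsto_mono_cone)
    show "(\<lambda>n. f \<theta>) \<longlonglongrightarrow> f \<theta>" by simp
    have "(\<lambda>n. S n + c n *\<^sub>R v) \<longlonglongrightarrow> s + 0 *\<^sub>R v" by (intro tendsto_intros s c0)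
    then show "(\<lambda>n. S n + c n *\<^sub>R v) \<longlonglongrightarrow> s" by simp
  qed (rule approx)
  moreover have "s \<le> w" if "\<forall>\<theta>. f \<theta> \<le> w" for w
  proof (rule tendsto_mono_cone[OF s])
    show "(\<lambda>n. w) \<longlonglongrightarrow> w" by simp
    show "S n \<le> w" for n using that by (intro S_le) auto
  qed
  ultimately show ?thesis unfolding f_def by blast
qed

lemma modulus_least_upper_bound:
  shows modulus_upper: "rpart (cscale (cis \<theta>) z) \<le> modulus z"
    and modulus_least: "(\<And>\<theta>. rpart (cscale (cis \<theta>) z) \<le> w) \<Longrightarrow> modulus z \<le> w"
proof -
  obtain m where m: "\<forall>\<theta>. rpart (cscale (cis \<theta>) z) \<le> m"
    "\<forall>w. (\<forall>\<theta>. rpart (cscale (cis \<theta>) z) \<le> w) \<longrightarrow> m \<le> w"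
    using modulus_exists by blast
  have "modulus z = m" unfolding modulus_def by (rule Least_equality) (use m in auto)
  then show "rpart (cscale (cis \<theta>) z) \<le> modulus z"
    and "(\<And>\<theta>. rpart (cscale (cis \<theta>) z) \<le> w) \<Longrightarrow> modulus z \<le> w"
    using m by auto
qed

lemma abs_rpart_le_modulus: "\<bar>rpart z\<bar> \<le> modulus z"
  using modulus_upper[of 0 z] modulus_upper[of pi z]
  by (intro abs_leI) (simp_all add: cscale_def)

lemma abs_ipart_le_modulus: "\<bar>ipart z\<bar> \<le> modulus z"
  using modulus_upper[of "- pi / 2" z] modulus_upper[of "pi / 2" z]
  by (intro abs_leI) (simp_all add: cscale_def)

lemma modulus_nonneg: "0 \<le> modulus z"
  using abs_rpart_le_modulus abs_ge_zero order_trans by blast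

lemma modulus_le_parts: "modulus z \<le> \<bar>rpart z\<bar> + \<bar>ipart z\<bar>"
proof (rule modulus_least)
  fix \<theta>
  have *: "r *\<^sub>R x \<le> \<bar>x\<bar>" if "\<bar>r\<bar> \<le> 1" for r and x :: 'a
  proof -
    have "r *\<^sub>R x \<le> \<bar>r\<bar> *\<^sub>R \<bar>x\<bar>" by (rule scaleR_le_scaleR_abs)
    also have "\<dots> \<le> 1 *\<^sub>R \<bar>x\<bar>" using that by (intro scaleR_right_mono) auto
    finally show ?thesis by simp
  qed
  have "cos \<theta> *\<^sub>R rpart z + (- sin \<theta>) *\<^sub>R ipart z \<le> \<bar>rpart z\<bar> + \<bar>ipart z\<bar>"
    by (intro add_mono *) (simp_all add: abs_le_iff)
  then show "rpart (cscale (cis \<theta>) z) \<le> \<bar>rpart z\<bar> + \<bar>ipart z\<bar>" by (simp add: cscale_def)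
qed

lemma modulus_triangle: "modulus (z + w) \<le> modulus z + modulus w"
proof (rule modulus_least)
  fix \<theta>
  have "rpart (cscale (cis \<theta>) (z + w)) = rpart (cscale (cis \<theta>) z) + rpart (cscale (cis \<theta>) w)"
    by (simp add: cscale_def algebra_simps)
  also have "\<dots> \<le> modulus z + modulus w" by (intro add_mono modulus_upper)
  finally show "rpart (cscale (cis \<theta>) (z + w)) \<le> modulus z + modulus w" .
qed

lemma modulus_eq_0_iff: "modulus z = 0 \<longleftrightarrow> z = 0"
proof
  assume "modulus z = 0"
  then have "\<bar>rpart z\<bar> = 0" "\<bar>ipart z\<bar> = 0"
    using abs_rpart_le_modulus[of z] abs_ipart_le_modulus[of z]
    by (auto intro: order.antisym)
  then show "z = 0" by (simp add: complexification_eq_iff)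
next
  assume "z = 0"
  then show "modulus z = 0"
    using modulus_le_parts[of z] modulus_nonneg[of z] by simp
qed

lemma modulus_cscale: "modulus (cscale c z) = cmod c *\<^sub>R modulus z"
proof -
  have le: "modulus (cscale c z) \<le> cmod c *\<^sub>R modulus z" for c and z :: "'a complexification"
  proof (rule modulus_least)
    fix \<theta>
    have "c = complex_of_real (cmod c) * cis (Arg c)" by (metis rcis_cmod_Arg rcis_def)
    then have "cis \<theta> * c = complex_of_real (cmod c) * cis (\<theta> + Arg c)"
      by (metis cis_mult mult.left_commute)
    then have "cscale (cis \<theta>) (cscale c z) = cmod c *\<^sub>R cscale (cis (\<theta> + Arg c)) z"
      by (metis cscale_of_real vector_space.vector_space_assms(3)[OF vector_space_cscale])
    then have "rpart (cscale (cis \<theta>) (cscale c z)) = cmod c *\<^sub>R rpart (cscale (cis (\<theta> + Arg c)) z)"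
      by simp
    also have "\<dots> \<le> cmod c *\<^sub>R modulus z" by (intro scaleR_left_mono modulus_upper) simp
    finally show "rpart (cscale (cis \<theta>) (cscale c z)) \<le> cmod c *\<^sub>R modulus z" .
  qed
  show ?thesis
  proof (cases "c = 0")
    case True
    then have "cscale c z = 0" by (simp add: cscale_def complexification_eq_iff)
    then show ?thesis using True by (simp add: modulus_eq_0_iff)
  next
    case False
    have "cscale (inverse c) (cscale c z) = cscale 1 z"
      using False by (metis left_inverse vector_space.vector_space_assms(3)[OF vector_space_cscale])
    then have "cscale (inverse c) (cscale c z) = z"
      by (metis vector_space.vector_space_assms(4)[OF vector_space_cscale])
    then have "modulus z \<le> cmod (inverse c) *\<^sub>R modulus (cscale c z)" by (metis le)
    then have "cmod c *\<^sub>R modulus z \<le> cmod c *\<^sub>R (cmod (inverse c) *\<^sub>R modulus (cscale c z))"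
      by (intro scaleR_left_mono) auto
    then have "cmod c *\<^sub>R modulus z \<le> modulus (cscale c z)" using False by (simp add: norm_inverse)
    then show ?thesis using le[of c z] by (intro order.antisym)
  qed
qed

lemma modulus_minus: "modulus (- z) = modulus z"
proof -
  have "cscale (- 1) z = - z" by (simp add: cscale_def complexification_eq_iff)
  then show ?thesis using modulus_cscale[of "- 1" z] by simp
qed

instantiation complexification :: (real_banach_lattice) real_normed_vector
begin

definition "norm z = norm (modulus z)"
definition "dist z w = norm (z - w :: 'a complexification)"
definition "sgn z = inverse (norm z) *\<^sub>R (z :: 'a complexification)"
definition "uniformity = (INF e\<in>{0<..}. principal {(z, w :: 'a complexification). dist z w < e})"
definition "open U \<longleftrightarrow>
  (\<forall>z\<in>U. \<forall>\<^sub>F (z', w) in uniformity. z' = z \<longrightarrow> (w :: 'a complexification) \<in> U)"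

instance
proof
  fix z w :: "'a complexification" and r :: real and U :: "'a complexification set"
  show "dist z w = norm (z - w)" by (rule dist_complexification_def)
  show "sgn z = inverse (norm z) *\<^sub>R z" by (rule sgn_complexification_def)
  show "uniformity = (INF e\<in>{0<..}. principal {(z, w :: 'a complexification). dist z w < e})"
    by (rule uniformity_complexification_def)
  show "open U \<longleftrightarrow> (\<forall>z\<in>U. \<forall>\<^sub>F (z', w) in uniformity. z' = z \<longrightarrow> w \<in> U)"
    by (rule open_complexification_def)
  show "norm z = 0 \<longleftrightarrow> z = 0" by (simp add: norm_complexification_def modulus_eq_0_iff)
  have "norm (modulus (z + w)) \<le> norm (modulus z + modulus w)"
    by (intro norm_mono_nonneg modulus_nonneg modulus_triangle)
  also have "\<dots> \<le> norm (modulus z) + norm (modulus w)" by (rule norm_triangle_ineq)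
  finally show "norm (z + w) \<le> norm z + norm w" by (simp add: norm_complexification_def)
  show "norm (r *\<^sub>R z) = \<bar>r\<bar> * norm z"
    by (simp add: norm_complexification_def modulus_cscale flip: cscale_of_real)
qed

end

lemma norm_cscale: "norm (cscale c z) = cmod c * norm z"
  for z :: "'a::real_banach_lattice complexification"
  by (simp add: norm_complexification_def modulus_cscale)

lemma norm_rpart_le: "norm (rpart z) \<le> norm z"
  and norm_ipart_le: "norm (ipart z) \<le> norm z"
  for z :: "'a::real_banach_lattice complexification"
  unfolding norm_complexification_def
  by (metis abs_rpart_le_modulus abs_ipart_le_modulus abs_ge_zero norm_abs_eq norm_mono_nonneg)+

lemma norm_le_parts: "norm z \<le> norm (rpart z) + norm (ipart z)"
  for z :: "'a::real_banach_lattice complexification"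
proof -
  have "norm z \<le> norm (\<bar>rpart z\<bar> + \<bar>ipart z\<bar>)"
    unfolding norm_complexification_def
    by (intro norm_mono_nonneg modulus_nonneg modulus_le_parts)
  also have "\<dots> \<le> norm (rpart z) + norm (ipart z)" by (metis norm_abs_eq norm_triangle_ineq)
  finally show ?thesis .
qed

instance complexification :: (real_banach_lattice) banach
proof
  fix X :: "nat \<Rightarrow> 'a complexification"
  assume X: "Cauchy X"
  have "Cauchy (\<lambda>n. rpart (X n))"
  proof (rule CauchyI)
    fix e :: real assume "0 < e"
    then obtain M where "\<forall>m\<ge>M. \<forall>n\<ge>M. norm (X m - X n) < e" using CauchyD[OF X] by blast
    then show "\<exists>M. \<forall>m\<ge>M. \<forall>n\<ge>M. norm (rpart (X m) - rpart (X n)) < e"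
      by (metis norm_rpart_le parts_simps(5) order_le_less_trans)
  qed
  then obtain a where a: "(\<lambda>n. rpart (X n)) \<longlonglongrightarrow> a"
    by (auto simp: Cauchy_convergent_iff convergent_def)
  have "Cauchy (\<lambda>n. ipart (X n))"
  proof (rule CauchyI)
    fix e :: real assume "0 < e"
    then obtain M where "\<forall>m\<ge>M. \<forall>n\<ge>M. norm (X m - X n) < e" using CauchyD[OF X] by blast
    then show "\<exists>M. \<forall>m\<ge>M. \<forall>n\<ge>M. norm (ipart (X m) - ipart (X n)) < e"
      by (metis norm_ipart_le parts_simps(6) order_le_less_trans)
  qed
  then obtain b where b: "(\<lambda>n. ipart (X n)) \<longlonglongrightarrow> b"
    by (auto simp: Cauchy_convergent_iff convergent_def)
  have lim: "(\<lambda>n. norm (rpart (X n) - a) + norm (ipart (X n) - b)) \<longlonglongrightarrow> 0 + 0"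
    by (intro tendsto_add tendsto_norm_zero) (use a b in \<open>simp_all add: LIM_zero_iff\<close>)
  have "norm (X n - Cplx a b) \<le> norm (rpart (X n) - a) + norm (ipart (X n) - b)" for n
    using norm_le_parts[of "X n - Cplx a b"] by simp
  then have "(\<lambda>n. X n - Cplx a b) \<longlonglongrightarrow> 0"
    using lim by (intro Lim_null_comparison[OF _ lim[simplified]]) auto
  then show "convergent X" by (auto simp: convergent_def LIM_zero_iff)
qed

section \<open>The d-topology\<close>

text \<open>
  The positive cone of the complexification of \<open>E\<close> is the cone \<open>{y. 0 \<le> y}\<close> of the real lattice
  \<open>E\<close>. A neighbourhood of \<open>z\<close> is given by a finite set of pairs \<open>(y, \<epsilon>)\<close> with \<open>y\<close> in the cone and
  \<open>\<epsilon> > 0\<close>.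
\<close>

definition d_open :: "'a::real_banach_lattice complexification set \<Rightarrow> bool" where
  "d_open U \<longleftrightarrow> (\<forall>z\<in>U. \<exists>F. finite F \<and> F \<subseteq> {0..} \<times> {0<..} \<and>
    (\<Inter>(y, \<epsilon>)\<in>F. {w. norm (inf (modulus (w - z)) y) < \<epsilon>}) \<subseteq> U)"

definition d_topology :: "'a::real_banach_lattice complexification topology" where
  "d_topology = topology d_open"

lemma openin_d_topology: "openin d_topology U \<longleftrightarrow> d_open U"
proof -
  let ?N = "\<lambda>F z. \<Inter>(y, \<epsilon>)\<in>F. {w. norm (inf (modulus (w - z)) y) < \<epsilon>}"
  have "d_open (S \<inter> T)" if S: "d_open S" and T: "d_open T"
    for S T :: "'a complexification set"
    unfolding d_open_def
  proof
    fix z assume z: "z \<in> S \<inter> T"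
    obtain F where F: "finite F" "F \<subseteq> {0..} \<times> {0<..}" "?N F z \<subseteq> S"
      using bspec[OF S[unfolded d_open_def], of z] z by auto
    obtain G where G: "finite G" "G \<subseteq> {0..} \<times> {0<..}" "?N G z \<subseteq> T"
      using bspec[OF T[unfolded d_open_def], of z] z by auto
    have "?N (F \<union> G) z = ?N F z \<inter> ?N G z" by (rule INT_Un)
    also have "\<dots> \<subseteq> S \<inter> T" using F(3) G(3) by (rule Int_mono)
    finally show "\<exists>F. finite F \<and> F \<subseteq> {0..} \<times> {0<..} \<and> ?N F z \<subseteq> S \<inter> T"
      using F G by (intro exI[of _ "F \<union> G"]) simp
  qed
  moreover have "d_open (\<Union>\<K>)" if "\<forall>K\<in>\<K>. d_open K" for \<K> :: "'a complexification set set"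
    unfolding d_open_def
  proof
    fix z assume "z \<in> \<Union>\<K>"
    then obtain K where K: "K \<in> \<K>" "z \<in> K" by blast
    then have "d_open K" using that by blast
    from bspec[OF this[unfolded d_open_def] K(2)]
    obtain F where "finite F" "F \<subseteq> {0..} \<times> {0<..}" "?N F z \<subseteq> K" by auto
    moreover have "K \<subseteq> \<Union>\<K>" using K(1) by (rule Union_upper)
    ultimately show "\<exists>F. finite F \<and> F \<subseteq> {0..} \<times> {0<..} \<and> ?N F z \<subseteq> \<Union>\<K>"
      by (intro exI[of _ F] conjI) (assumption | erule order_trans)+
  qed
  ultimately have "istopology (d_open :: 'a complexification set \<Rightarrow> bool)"
    unfolding istopology_def by simp
  then show ?thesis by (simp add: d_topology_def topology_inverse')
qed

lemma topspace_d_topology [simp]: "topspace d_topology = UNIV"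
proof -
  have "d_open UNIV" unfolding d_open_def by blast
  then have "UNIV \<subseteq> topspace d_topology" by (intro openin_subset) (simp add: openin_d_topology)
  then show ?thesis by blast
qed

lemma inf_add_le:
  fixes a b y :: "'a::lattice_ab_group_add_abs"
  assumes "0 \<le> a" "0 \<le> b" "0 \<le> y"
  shows "inf (a + b) y \<le> inf a y + inf b y"
proof -
  have "y \<le> a + y" "y \<le> y + b" "y \<le> y + y" using assms by simp_all
  then have "inf (a + b) y \<le> inf (inf (a + b) (y + b)) (inf (a + y) (y + y))"
    by (meson inf.cobounded1 inf.cobounded2 inf_greatest order_trans)
  also have "\<dots> = inf (inf a y + b) (inf a y + y)" by (simp only: add_inf_distrib_right)
  also have "\<dots> = inf a y + inf b y" by (simp only: add_inf_distrib_left)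
  finally show ?thesis .
qed

lemma d_open_basic:
  assumes y: "0 \<le> y"
  shows "d_open {w. norm (inf (modulus (w - x)) y) < \<epsilon>}"
  unfolding d_open_def
proof
  fix z assume "z \<in> {w. norm (inf (modulus (w - x)) y) < \<epsilon>}"
  then have z: "norm (inf (modulus (z - x)) y) < \<epsilon>" by simp
  define \<delta> where "\<delta> = \<epsilon> - norm (inf (modulus (z - x)) y)"
  have "{w. norm (inf (modulus (w - z)) y) < \<delta>} \<subseteq> {w. norm (inf (modulus (w - x)) y) < \<epsilon>}"
  proof safe
    fix w assume w: "norm (inf (modulus (w - z)) y) < \<delta>"
    have "modulus (w - x) \<le> modulus (w - z) + modulus (z - x)"
      using modulus_triangle[of "w - z" "z - x"] by simp
    then have "inf (modulus (w - x)) y \<le> inf (modulus (w - z) + modulus (z - x)) y"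
      by (rule inf_mono) simp
    also have "\<dots> \<le> inf (modulus (w - z)) y + inf (modulus (z - x)) y"
      using y by (intro inf_add_le modulus_nonneg)
    finally have "norm (inf (modulus (w - x)) y)
        \<le> norm (inf (modulus (w - z)) y + inf (modulus (z - x)) y)"
      using y by (intro norm_mono_nonneg) (simp_all add: modulus_nonneg)
    also have "\<dots> \<le> norm (inf (modulus (w - z)) y) + norm (inf (modulus (z - x)) y)"
      by (rule norm_triangle_ineq)
    finally show "norm (inf (modulus (w - x)) y) < \<epsilon>" using w by (simp add: \<delta>_def)
  qed
  then show "\<exists>F. finite F \<and> F \<subseteq> {0..} \<times> {0<..} \<and>
      (\<Inter>(y, \<epsilon>)\<in>F. {w. norm (inf (modulus (w - z)) y) < \<epsilon>})
        \<subseteq> {w. norm (inf (modulus (w - x)) y) < \<epsilon>}"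
    using y z by (intro exI[of _ "{(y, \<delta>)}"]) (auto simp: \<delta>_def)
qed

lemma limitin_d_topology:
  "limitin d_topology f x G \<longleftrightarrow> (\<forall>y\<ge>0. ((\<lambda>\<alpha>. norm (inf (modulus (f \<alpha> - x)) y)) \<longlongrightarrow> 0) G)"
proof
  assume L: "limitin d_topology f x G"
  show "\<forall>y\<ge>0. ((\<lambda>\<alpha>. norm (inf (modulus (f \<alpha> - x)) y)) \<longlongrightarrow> 0) G"
  proof (intro allI impI tendstoI)
    fix y :: 'a and e :: real assume y: "0 \<le> y" and e: "0 < e"
    have "x \<in> {w. norm (inf (modulus (w - x)) y) < e}"
      using y e modulus_eq_0_iff[of "0 :: 'a complexification"] by (simp add: inf_absorb1)
    then have "\<forall>\<^sub>F \<alpha> in G. f \<alpha> \<in> {w. norm (inf (modulus (w - x)) y) < e}"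
      using L d_open_basic[OF y, of x e] unfolding limitin_def openin_d_topology by blast
    then show "\<forall>\<^sub>F \<alpha> in G. dist (norm (inf (modulus (f \<alpha> - x)) y)) 0 < e" by simp
  qed
next
  assume C: "\<forall>y\<ge>0. ((\<lambda>\<alpha>. norm (inf (modulus (f \<alpha> - x)) y)) \<longlongrightarrow> 0) G"
  show "limitin d_topology f x G"
    unfolding limitin_def openin_d_topology
  proof (intro conjI allI impI)
    show "x \<in> topspace d_topology" by simp
    fix U assume "d_open U \<and> x \<in> U"
    then obtain F where F: "finite F" "F \<subseteq> {0..} \<times> {0<..}"
      "(\<Inter>(y, \<epsilon>)\<in>F. {w. norm (inf (modulus (w - x)) y) < \<epsilon>}) \<subseteq> U"
      unfolding d_open_def by blast
    have "\<forall>\<^sub>F \<alpha> in G. \<forall>p\<in>F. norm (inf (modulus (f \<alpha> - x)) (fst p)) < snd p"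
    proof (rule eventually_ball_finite[OF F(1)], rule ballI)
      fix p assume "p \<in> F"
      then have "0 \<le> fst p" "0 < snd p" using F(2) by auto
      then show "\<forall>\<^sub>F \<alpha> in G. norm (inf (modulus (f \<alpha> - x)) (fst p)) < snd p"
        using C by (intro order_tendstoD) auto
    qed
    then show "\<forall>\<^sub>F \<alpha> in G. f \<alpha> \<in> U"
    proof eventually_elim
      case (elim \<alpha>)
      then have "f \<alpha> \<in> (\<Inter>(y, \<epsilon>)\<in>F. {w. norm (inf (modulus (w - x)) y) < \<epsilon>})" by auto
      then show ?case using F(3) by blast
    qed
  qed
qed

abbreviation d_compact :: "'a::real_banach_lattice complexification set \<Rightarrow> bool" where
  "d_compact A \<equiv> compactin d_topology A"

section \<open>The two set functions\<close>

text \<open>Both are meaningful only for bounded sets, where the infima are over nonempty sets.\<close>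

definition chi :: "'b::metric_space set \<Rightarrow> real" where
  "chi A = Inf {\<delta>. 0 < \<delta> \<and> (\<exists>C. finite C \<and> A \<subseteq> (\<Union>c\<in>C. cball c \<delta>))}"

definition order_interval :: "'a::real_banach_lattice \<Rightarrow> 'a complexification set" where
  "order_interval u = {z. modulus z \<le> u}"

definition rho :: "'a::real_banach_lattice complexification set \<Rightarrow> real" where
  "rho A = Inf {\<delta>. 0 < \<delta> \<and> (\<exists>u\<ge>0. A \<subseteq> {a + \<delta> *\<^sub>R b | a b. a \<in> order_interval u \<and> b \<in> cball 0 1})}"

end

theory Submission
  imports Defs
begin

text \<open>Only \<open>\<chi>(A) \<le> \<rho>(A)\<close> needs work. Let \<open>A \<subseteq> [-u, u] + \<delta>B\<close>. Every \<open>a\<close> has an approximate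
  truncation \<open>c\<close> with \<open>|c| \<le> 3u\<close> and \<open>|a - c| \<le> (|a| - u)\<^sup>+ + h\<close> for a small \<open>h\<close>. Then
  \<open>|w - c| \<le> (|w| - u)\<^sup>+ + h + 4 (|w - a| \<and> u)\<close> for all \<open>w\<close>, and for \<open>w \<in> A\<close> the first term has norm
  at most \<open>\<delta>\<close>. By d-compactness finitely many \<open>a\<close> make the last term small on all of \<open>A\<close>.

  The truncation \<open>a (u \<and> |a|) / |a|\<close> is not a lattice expression, but it can be approximated by
  lattice expressions in the real part, imaginary part and modulus of \<open>a\<close>. The estimates are then
  checked pointwise, since real-valued lattice homomorphisms determine the order of a principal
  ideal; these homomorphisms come from cones that are maximal among the sup-closed, downward closed
  ones avoiding the order unit.\<close>

section \<open>Real-valued lattice homomorphisms on principal ideals\<close>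

definition principal_ideal :: "'a::real_banach_lattice \<Rightarrow> 'a set" where
  "principal_ideal e = {x. \<exists>r. \<bar>x\<bar> \<le> r *\<^sub>R e}"

lemma principal_idealI:
  assumes "x \<le> r *\<^sub>R e" "- x \<le> r *\<^sub>R e"
  shows "x \<in> principal_ideal e"
  using abs_leI[OF assms] by (auto simp: principal_ideal_def)

lemma principal_idealE:
  assumes "x \<in> principal_ideal e"
  obtains r where "x \<le> r *\<^sub>R e" "- x \<le> r *\<^sub>R e"
  using assms abs_ge_self abs_ge_minus_self order_trans unfolding principal_ideal_def by blast

lemma principal_ideal_add:
  assumes "x \<in> principal_ideal e" "y \<in> principal_ideal e"
  shows "x + y \<in> principal_ideal e"
proof -
  obtain r s where "x \<le> r *\<^sub>R e" "- x \<le> r *\<^sub>R e" "y \<le> s *\<^sub>R e" "- y \<le> s *\<^sub>R e"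
    using assms by (elim principal_idealE)
  then have "x + y \<le> (r + s) *\<^sub>R e" "- x + - y \<le> (r + s) *\<^sub>R e"
    unfolding scaleR_left_distrib by (simp_all only: add_mono)
  then show ?thesis by (intro principal_idealI[of _ "r + s"]) simp_all
qed

lemma principal_ideal_scaleR:
  assumes "x \<in> principal_ideal e"
  shows "c *\<^sub>R x \<in> principal_ideal e"
proof -
  obtain r where r: "\<bar>x\<bar> \<le> r *\<^sub>R e" using assms by (auto simp: principal_ideal_def)
  have "d *\<^sub>R x \<le> (\<bar>c\<bar> * r) *\<^sub>R e" if "\<bar>d\<bar> = \<bar>c\<bar>" for d
  proof -
    have "d *\<^sub>R x \<le> \<bar>d\<bar> *\<^sub>R \<bar>x\<bar>" by (rule scaleR_le_scaleR_abs)
    also have "\<dots> \<le> \<bar>d\<bar> *\<^sub>R (r *\<^sub>R e)" using r by (intro scaleR_left_mono) auto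
    finally show ?thesis using that by simp
  qed
  from this[of c] this[of "- c"] show ?thesis by (intro principal_idealI) auto
qed

lemma principal_ideal_uminus: "x \<in> principal_ideal e \<Longrightarrow> - x \<in> principal_ideal e"
  using principal_ideal_scaleR[of x e "- 1"] by simp

lemma principal_ideal_diff:
  "x \<in> principal_ideal e \<Longrightarrow> y \<in> principal_ideal e \<Longrightarrow> x - y \<in> principal_ideal e"
  using principal_ideal_add[OF _ principal_ideal_uminus] by fastforce

lemma principal_ideal_sup:
  assumes "0 \<le> e" "x \<in> principal_ideal e" "y \<in> principal_ideal e"
  shows "sup x y \<in> principal_ideal e"
proof -
  obtain r s where h: "x \<le> r *\<^sub>R e" "- x \<le> r *\<^sub>R e" "y \<le> s *\<^sub>R e"
    using assms by (elim principal_idealE)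
  have m: "r *\<^sub>R e \<le> max r s *\<^sub>R e" "s *\<^sub>R e \<le> max r s *\<^sub>R e"
    using assms(1) by (auto intro: scaleR_right_mono)
  have "sup x y \<le> max r s *\<^sub>R e" using h m by (meson le_supI order_trans)
  moreover have "- sup x y \<le> - x" by simp
  then have "- sup x y \<le> max r s *\<^sub>R e" using h m by (meson order_trans)
  ultimately show ?thesis by (rule principal_idealI)
qed

lemma principal_ideal_inf:
  "0 \<le> e \<Longrightarrow> x \<in> principal_ideal e \<Longrightarrow> y \<in> principal_ideal e \<Longrightarrow> inf x y \<in> principal_ideal e"
  unfolding inf_eq_neg_sup by (intro principal_ideal_uminus principal_ideal_sup)

lemma principal_ideal_self: "0 \<le> e \<Longrightarrow> e \<in> principal_ideal e"
  by (rule principal_idealI[of _ 1]) (auto intro: order_trans[of _ 0])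

lemma principal_ideal_zero: "0 \<le> e \<Longrightarrow> 0 \<in> principal_ideal e"
  using principal_ideal_scaleR[OF principal_ideal_self, of e 0] by simp

lemma principal_ideal_sum:
  "finite J \<Longrightarrow> 0 \<le> e \<Longrightarrow> (\<And>j. j \<in> J \<Longrightarrow> f j \<in> principal_ideal e) \<Longrightarrow> sum f J \<in> principal_ideal e"
  by (induction J rule: finite_induct) (auto intro: principal_ideal_add principal_ideal_zero)

text \<open>Only the values on \<open>principal_ideal e\<close> are constrained, so that a total
  function can stand for a functional on the ideal. No normalisation at \<open>e\<close> is imposed.
  Infima and order come from suprema and negation, see \<open>hom_inf\<close> and
  \<open>hom_mono\<close>.\<close>

definition real_lattice_hom :: "'a::real_banach_lattice \<Rightarrow> ('a \<Rightarrow> real) \<Rightarrow> bool" where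
  "real_lattice_hom e \<phi> \<longleftrightarrow>
    (\<forall>x\<in>principal_ideal e. \<forall>y\<in>principal_ideal e.
      \<phi> (x + y) = \<phi> x + \<phi> y \<and> \<phi> (sup x y) = max (\<phi> x) (\<phi> y)) \<and>
    (\<forall>c. \<forall>x\<in>principal_ideal e. \<phi> (c *\<^sub>R x) = c * \<phi> x)"

section \<open>Sup-closed cones and the functionals of maximal ones\<close>

text \<open>Modelled on the set where a lattice homomorphism \<phi> is nonpositive. The plan is to
  find a large set of this kind and to read \<phi> off from it.\<close>

definition sup_cone :: "'a::real_banach_lattice set \<Rightarrow> bool" where
  "sup_cone N \<longleftrightarrow> 0 \<in> N \<and> (\<forall>x\<in>N. \<forall>y\<in>N. x + y \<in> N \<and> sup x y \<in> N) \<and>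
    (\<forall>x\<in>N. \<forall>c\<ge>0. c *\<^sub>R x \<in> N) \<and> (\<forall>x\<in>N. \<forall>y\<le>x. y \<in> N)"

lemma sup_coneD:
  assumes "sup_cone N"
  shows "0 \<in> N" "x \<in> N \<Longrightarrow> y \<in> N \<Longrightarrow> x + y \<in> N" "x \<in> N \<Longrightarrow> y \<in> N \<Longrightarrow> sup x y \<in> N"
    "x \<in> N \<Longrightarrow> 0 \<le> c \<Longrightarrow> c *\<^sub>R x \<in> N" "x \<in> N \<Longrightarrow> y \<le> x \<Longrightarrow> y \<in> N"
  using assms by (auto simp: sup_cone_def)

lemma sup_cone_scaleR_cancel:
  assumes "sup_cone N" "0 < c" "c *\<^sub>R x \<in> N"
  shows "x \<in> N"
proof -
  have "inverse c *\<^sub>R (c *\<^sub>R x) \<in> N" using assms by (simp only: sup_coneD(4) less_imp_le inverse_nonnegative_iff_nonnegative)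
  then show ?thesis using assms(2) by simp
qed

text \<open>Zorn's lemma applies because any two elements of the union of a chain lie in one common
  member, so the closure conditions pass to the union.\<close>

lemma maximal_sup_cone:
  assumes "sup_cone N0" "e \<notin> N0"
  obtains N where "N0 \<subseteq> N" "sup_cone N" "e \<notin> N"
    "\<forall>N'. sup_cone N' \<and> e \<notin> N' \<and> N \<subseteq> N' \<longrightarrow> N' = N"
proof -
  define \<A> where "\<A> = {N. N0 \<subseteq> N \<and> sup_cone N \<and> e \<notin> N}"
  have "\<exists>M\<in>\<A>. \<forall>X\<in>\<A>. M \<subseteq> X \<longrightarrow> X = M"
  proof (rule subset_Zorn_nonempty)
    show "\<A> \<noteq> {}" using assms by (auto simp: \<A>_def)
    fix C assume C: "C \<noteq> {}" "subset.chain \<A> C"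
    then have sub: "C \<subseteq> \<A>" and ch: "\<And>X Y. X \<in> C \<Longrightarrow> Y \<in> C \<Longrightarrow> X \<subseteq> Y \<or> Y \<subseteq> X"
      by (auto simp: subset_chain_def)
    have cone: "sup_cone X" if "X \<in> C" for X using sub that by (auto simp: \<A>_def)
    have pair: "\<exists>X\<in>C. x \<in> X \<and> y \<in> X" if "x \<in> \<Union>C" "y \<in> \<Union>C" for x y
      using that ch by (meson UnionE subsetD)
    have "sup_cone (\<Union>C)"
      unfolding sup_cone_def
    proof (intro conjI ballI allI impI)
      show "0 \<in> \<Union>C" using C(1) cone sup_coneD(1) by blast
    next
      fix x y assume "x \<in> \<Union>C" "y \<in> \<Union>C"
      then obtain X where "X \<in> C" "x \<in> X" "y \<in> X" using pair by blast
      then show "x + y \<in> \<Union>C" "sup x y \<in> \<Union>C" using cone sup_coneD(2,3) by blast+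
    next
      fix x c assume "x \<in> \<Union>C" "0 \<le> (c::real)"
      then show "c *\<^sub>R x \<in> \<Union>C" using cone sup_coneD(4) by blast
    next
      fix x y assume "x \<in> \<Union>C" "y \<le> x"
      then show "y \<in> \<Union>C" using cone sup_coneD(5) by blast
    qed
    moreover have "N0 \<subseteq> \<Union>C" using C(1) sub by (auto simp: \<A>_def)
    moreover have "e \<notin> \<Union>C" using sub by (auto simp: \<A>_def)
    ultimately show "\<Union>C \<in> \<A>" by (simp add: \<A>_def)
  qed
  then obtain M where M: "M \<in> \<A>" "\<And>X. X \<in> \<A> \<Longrightarrow> M \<subseteq> X \<Longrightarrow> X = M" by blast
  show ?thesis
  proof (rule that[of M])
    show "N0 \<subseteq> M" "sup_cone M" "e \<notin> M" using M(1) by (auto simp: \<A>_def)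
    show "\<forall>N'. sup_cone N' \<and> e \<notin> N' \<and> M \<subseteq> N' \<longrightarrow> N' = M"
      using M by (auto simp: \<A>_def)
  qed
qed

text \<open>For a \<open>sup_cone\<close> \<open>N\<close> with \<open>a\<close> in
  \<open>N\<close>, this is the smallest \<open>sup_cone\<close> that contains \<open>N\<close> and
  \<open>- a\<close>.\<close>

definition adjoin_neg :: "'a::real_banach_lattice set \<Rightarrow> 'a \<Rightarrow> 'a set" where
  "adjoin_neg N a = {x. \<exists>n\<in>N. \<exists>t\<ge>0. x \<le> n - t *\<^sub>R a}"

lemma adjoin_neg_superset: "N \<subseteq> adjoin_neg N a"
  unfolding adjoin_neg_def by (auto intro!: bexI exI[of _ "0::real"])

lemma neg_in_adjoin_neg: "sup_cone N \<Longrightarrow> - a \<in> adjoin_neg N a"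
  unfolding adjoin_neg_def by (auto intro!: bexI[of _ 0] exI[of _ "1::real"] sup_coneD(1))

text \<open>As \<open>a\<close> is in \<open>N\<close>, the coefficient of \<open>- a\<close> can be
  raised from \<open>t\<close> to \<open>m\<close> by adding \<open>(m - t) a\<close> to the element
  of \<open>N\<close>. Two elements thus get a common coefficient, and their supremum can be formed
  inside \<open>N\<close>.\<close>

lemma sup_cone_adjoin_neg:
  assumes N: "sup_cone N" and a: "a \<in> N"
  shows "sup_cone (adjoin_neg N a)"
proof -
  have pair: "\<exists>n\<in>N. \<exists>n'\<in>N. \<exists>t\<ge>0. x \<le> n - t *\<^sub>R a \<and> y \<le> n' - t *\<^sub>R a"
    if xy: "x \<in> adjoin_neg N a" "y \<in> adjoin_neg N a" for x y
  proof -
    obtain n t n' t' where h: "n \<in> N" "0 \<le> t" "x \<le> n - t *\<^sub>R a" "n' \<in> N" "0 \<le> t'" "y \<le> n' - t' *\<^sub>R a"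
      using xy unfolding adjoin_neg_def by blast
    define m where "m = max t t'"
    have "n + (m - t) *\<^sub>R a \<in> N" "n' + (m - t') *\<^sub>R a \<in> N"
      using h a by (auto simp: m_def intro!: sup_coneD(2,4)[OF N])
    moreover have "x \<le> (n + (m - t) *\<^sub>R a) - m *\<^sub>R a" "y \<le> (n' + (m - t') *\<^sub>R a) - m *\<^sub>R a"
      using h by (simp_all add: algebra_simps)
    moreover have "0 \<le> m" using h by (simp add: m_def)
    ultimately show ?thesis by blast
  qed
  show ?thesis
    unfolding sup_cone_def
  proof (intro conjI ballI allI impI)
    show "0 \<in> adjoin_neg N a" using adjoin_neg_superset sup_coneD(1)[OF N] by blast
  next
    fix x y assume "x \<in> adjoin_neg N a" "y \<in> adjoin_neg N a"
    then obtain n n' t where h: "n \<in> N" "n' \<in> N" "0 \<le> t" "x \<le> n - t *\<^sub>R a" "y \<le> n' - t *\<^sub>R a"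
      using pair by blast
    have "x + y \<le> (n - t *\<^sub>R a) + (n' - t *\<^sub>R a)" using h by (intro add_mono)
    also have "\<dots> = (n + n') - (2 * t) *\<^sub>R a" by (simp add: algebra_simps flip: scaleR_2)
    finally show "x + y \<in> adjoin_neg N a"
      unfolding adjoin_neg_def using h sup_coneD(2)[OF N]
      by (auto intro!: bexI[of _ "n + n'"] exI[of _ "2 * t"])
    have "n - t *\<^sub>R a \<le> sup n n' - t *\<^sub>R a" "n' - t *\<^sub>R a \<le> sup n n' - t *\<^sub>R a"
      by (simp_all add: diff_right_mono)
    then have "sup x y \<le> sup n n' - t *\<^sub>R a" using h by (meson order_trans le_supI)
    then show "sup x y \<in> adjoin_neg N a"
      unfolding adjoin_neg_def using h sup_coneD(3)[OF N] by blast
  next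
    fix x c assume "x \<in> adjoin_neg N a" "0 \<le> (c::real)"
    then obtain n t where h: "n \<in> N" "0 \<le> t" "x \<le> n - t *\<^sub>R a" by (auto simp: adjoin_neg_def)
    then have "c *\<^sub>R x \<le> c *\<^sub>R (n - t *\<^sub>R a)" using \<open>0 \<le> c\<close> by (intro scaleR_left_mono)
    then have "c *\<^sub>R x \<le> c *\<^sub>R n - (c * t) *\<^sub>R a" by (simp add: algebra_simps)
    moreover have "c *\<^sub>R n \<in> N" "0 \<le> c * t" using h \<open>0 \<le> c\<close> sup_coneD(4)[OF N] by auto
    ultimately show "c *\<^sub>R x \<in> adjoin_neg N a" unfolding adjoin_neg_def by blast
  next
    fix x y assume "x \<in> adjoin_neg N a" "y \<le> x"
    then show "y \<in> adjoin_neg N a" unfolding adjoin_neg_def by (auto intro: order_trans)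
  qed
qed

lemma archimedean_scaleR_le:
  fixes e :: "'a::real_banach_lattice"
  assumes "\<And>\<epsilon>. 0 < \<epsilon> \<Longrightarrow> x \<le> y + \<epsilon> *\<^sub>R e"
  shows "x \<le> y"
proof (rule tendsto_mono_cone)
  show "(\<lambda>n::nat. x) \<longlonglongrightarrow> x" by simp
  have "(\<lambda>n. y + inverse (real (Suc n)) *\<^sub>R e) \<longlonglongrightarrow> y + 0 *\<^sub>R e"
    by (intro tendsto_intros LIMSEQ_inverse_real_of_nat)
  then show "(\<lambda>n. y + inverse (real (Suc n)) *\<^sub>R e) \<longlonglongrightarrow> y" by simp
  show "x \<le> y + inverse (real (Suc n)) *\<^sub>R e" for n by (rule assms) simp
qed

lemma diff_scaleR_le:
  fixes e :: "'a::real_banach_lattice"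
  assumes "0 \<le> e" "0 < \<epsilon>"
  shows "x - \<epsilon> *\<^sub>R e \<le> x"
  using assms by (simp add: scaleR_nonneg_nonneg)

text \<open>A maximal cone is closed in the direction \<open>e\<close>, and a boundary element \<open>a\<close> of it satisfies
  \<open>- a \<in> N\<close>, since otherwise \<open>- a\<close> could be adjoined. So \<open>N \<inter> - N\<close> has codimension one in the
  ideal.\<close>

lemma maximal_sup_cone_coordinate:
  assumes e: "0 \<le> e" and N: "sup_cone N" "e \<notin> N"
    and max: "\<forall>N'. sup_cone N' \<and> e \<notin> N' \<and> N \<subseteq> N' \<longrightarrow> N' = N"
    and x: "x \<in> principal_ideal e"
  shows "\<exists>t. x - t *\<^sub>R e \<in> N \<and> t *\<^sub>R e - x \<in> N"
proof -
  obtain r where r: "\<bar>x\<bar> \<le> r *\<^sub>R e" using x by (auto simp: principal_ideal_def)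
  define Cl where "Cl = {x. \<forall>\<epsilon>>0. x - \<epsilon> *\<^sub>R e \<in> N}"
  have sub: "N \<subseteq> Cl"
    using e unfolding Cl_def by (blast intro: sup_coneD(5)[OF N(1)] diff_scaleR_le)
  have "sup_cone Cl"
    unfolding sup_cone_def
  proof (intro conjI ballI allI impI)
    show "0 \<in> Cl" using sub sup_coneD(1)[OF N(1)] by blast
  next
    fix x y assume h: "x \<in> Cl" "y \<in> Cl"
    show "x + y \<in> Cl"
      unfolding Cl_def
    proof safe
      fix \<epsilon> :: real assume "\<epsilon> > 0"
      then have "(x - (\<epsilon>/2) *\<^sub>R e) + (y - (\<epsilon>/2) *\<^sub>R e) \<in> N"
        using h by (intro sup_coneD(2)[OF N(1)]) (auto simp: Cl_def)
      also have "(x - (\<epsilon>/2) *\<^sub>R e) + (y - (\<epsilon>/2) *\<^sub>R e) = x + y - (\<epsilon>/2 + \<epsilon>/2) *\<^sub>R e"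
        by (simp only: scaleR_left_distrib) simp
      finally show "x + y - \<epsilon> *\<^sub>R e \<in> N" by simp
    qed
    show "sup x y \<in> Cl"
      unfolding Cl_def
    proof safe
      fix \<epsilon> :: real assume "\<epsilon> > 0"
      then have "sup (x - \<epsilon> *\<^sub>R e) (y - \<epsilon> *\<^sub>R e) \<in> N"
        using h by (intro sup_coneD(3)[OF N(1)]) (auto simp: Cl_def)
      then show "sup x y - \<epsilon> *\<^sub>R e \<in> N"
        by (simp add: diff_conv_add_uminus add_sup_distrib_right del: add_uminus_conv_diff)
    qed
  next
    fix x c assume h: "x \<in> Cl" "0 \<le> (c::real)"
    show "c *\<^sub>R x \<in> Cl"
    proof (cases "c = 0")
      case True
      then show ?thesis using sub sup_coneD(1)[OF N(1)] by auto
    next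
      case False
      show ?thesis
        unfolding Cl_def
      proof safe
        fix \<epsilon> :: real assume "\<epsilon> > 0"
        then have "c *\<^sub>R (x - (\<epsilon>/c) *\<^sub>R e) \<in> N"
          using h False by (intro sup_coneD(4)[OF N(1)]) (auto simp: Cl_def)
        then show "c *\<^sub>R x - \<epsilon> *\<^sub>R e \<in> N" using False by (simp add: algebra_simps)
      qed
    qed
  next
    fix x y assume h: "x \<in> Cl" "y \<le> x"
    then show "y \<in> Cl"
      unfolding Cl_def by (blast intro: sup_coneD(5)[OF N(1)] diff_right_mono)
  qed
  moreover have "e \<notin> Cl"
  proof
    assume "e \<in> Cl"
    then have "e - (1/2) *\<^sub>R e \<in> N" by (auto simp: Cl_def)
    then have "2 *\<^sub>R (e - (1/2) *\<^sub>R e) \<in> N" by (intro sup_coneD(4)[OF N(1)]) auto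
    then show False using N(2) by (simp add: scaleR_diff_right scaleR_2)
  qed
  ultimately have Cl: "Cl = N" using sub max by blast
  \<comment> \<open>The infimum of \<open>T\<close> will be the value at \<open>x\<close> of the
    homomorphism belonging to \<open>N\<close>; \<open>T\<close> is bounded below because
    \<open>e\<close> is not in \<open>N\<close>.\<close>
  define T where "T = {t. x - t *\<^sub>R e \<in> N}"
  have "x - r *\<^sub>R e \<le> 0" using r abs_ge_self order_trans by fastforce
  then have rT: "r \<in> T" using sup_coneD(1,5)[OF N(1)] by (auto simp: T_def)
  have lb: "- r \<le> t" if "t \<in> T" for t
  proof (rule ccontr)
    assume "\<not> - r \<le> t"
    then have neg: "- r - t > 0" by simp
    have "- x \<le> r *\<^sub>R e" using r abs_ge_minus_self order_trans by blast
    then have "- (r *\<^sub>R e) \<le> x" by (simp add: minus_le_iff)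
    then have "(- r - t) *\<^sub>R e \<le> x - t *\<^sub>R e"
      by (simp add: scaleR_left_diff_distrib diff_right_mono)
    then have "(- r - t) *\<^sub>R e \<in> N" using that sup_coneD(5)[OF N(1)] by (auto simp: T_def)
    then have "e \<in> N" by (rule sup_cone_scaleR_cancel[OF N(1) neg])
    then show False using N(2) by simp
  qed
  define a where "a = x - Inf T *\<^sub>R e"
  have bdd: "bdd_below T" using lb by (auto simp: bdd_below_def)
  have "a \<in> Cl"
    unfolding Cl_def
  proof safe
    fix \<epsilon> :: real assume "\<epsilon> > 0"
    then obtain t where t: "t \<in> T" "t < Inf T + \<epsilon>"
      using rT bdd cInf_less_iff[of T "Inf T + \<epsilon>"] by auto
    then have "t *\<^sub>R e \<le> (Inf T + \<epsilon>) *\<^sub>R e" using e by (intro scaleR_right_mono) auto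
    then have "x - (Inf T + \<epsilon>) *\<^sub>R e \<le> x - t *\<^sub>R e" by simp
    then have "x - (Inf T + \<epsilon>) *\<^sub>R e \<in> N" using t sup_coneD(5)[OF N(1)] by (auto simp: T_def)
    then show "a - \<epsilon> *\<^sub>R e \<in> N" by (simp add: a_def algebra_simps)
  qed
  then have aN: "a \<in> N" using Cl by simp
  \<comment> \<open>If \<open>e\<close> were below \<open>n - t a\<close>, then
    \<open>t > 0\<close>, and dividing \<open>e + t a\<close> by \<open>t\<close> would put
    \<open>Inf T - 1/t\<close> into \<open>T\<close>.\<close>
  have "e \<notin> adjoin_neg N a"
  proof
    assume "e \<in> adjoin_neg N a"
    then obtain n t where h: "n \<in> N" "0 \<le> t" "e \<le> n - t *\<^sub>R a" by (auto simp: adjoin_neg_def)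
    have eN: "e + t *\<^sub>R a \<in> N" using h sup_coneD(5)[OF N(1) h(1)] by (simp add: le_diff_eq)
    then have t: "t > 0" using h(2) N(2) by (cases "t = 0") auto
    have "inverse t *\<^sub>R (e + t *\<^sub>R a) \<in> N" using eN t by (intro sup_coneD(4)[OF N(1)]) auto
    also have "inverse t *\<^sub>R (e + t *\<^sub>R a) = x - (Inf T - inverse t) *\<^sub>R e"
      using t by (simp add: scaleR_add_right scaleR_left_diff_distrib a_def)
    finally have "x - (Inf T - inverse t) *\<^sub>R e \<in> N" .
    then have "Inf T \<le> Inf T - inverse t" using bdd by (intro cInf_lower) (auto simp: T_def)
    then show False using t by simp
  qed
  then have "adjoin_neg N a = N"
    using max sup_cone_adjoin_neg[OF N(1) aN] adjoin_neg_superset by blast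
  then have "- a \<in> N" using neg_in_adjoin_neg[OF N(1), of a] by simp
  then show ?thesis using aN by (intro exI[of _ "Inf T"]) (simp add: a_def)
qed

text \<open>The value \<phi> x is the coefficient \<open>t\<close> for which \<open>x - t e\<close>
  and its negative both lie in \<open>N\<close>. Upper and lower bounds on \<phi> then become
  memberships in \<open>N\<close> (\<open>char\<close> and \<open>char'\<close>), and the
  homomorphism laws become the closure properties of \<open>N\<close>.\<close>

lemma maximal_sup_cone_hom:
  assumes e: "0 \<le> e" and N: "sup_cone N" "e \<notin> N"
    and max: "\<forall>N'. sup_cone N' \<and> e \<notin> N' \<and> N \<subseteq> N' \<longrightarrow> N' = N"
  obtains \<phi> where "real_lattice_hom e \<phi>" "\<And>x t. x \<in> principal_ideal e \<Longrightarrow> \<phi> x \<le> t \<longleftrightarrow> x - t *\<^sub>R e \<in> N"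
proof -
  let ?I = "principal_ideal e"
  have "\<forall>x\<in>?I. \<exists>t. x - t *\<^sub>R e \<in> N \<and> t *\<^sub>R e - x \<in> N"
    using maximal_sup_cone_coordinate[OF e N max] by blast
  then obtain \<phi> where \<phi>: "\<And>x. x \<in> ?I \<Longrightarrow> x - \<phi> x *\<^sub>R e \<in> N" "\<And>x. x \<in> ?I \<Longrightarrow> \<phi> x *\<^sub>R e - x \<in> N"
    by metis
  \<comment> \<open>This is where \<open>e\<close> not being in \<open>N\<close> enters: a positive
    multiple of \<open>e\<close> in \<open>N\<close> would bring \<open>e\<close> along. It makes
    the coefficient unique.\<close>
  have le: "t \<le> s" if "(t - s) *\<^sub>R e \<in> N" for s t
  proof (rule ccontr)
    assume "\<not> t \<le> s"
    then have "e \<in> N" using sup_cone_scaleR_cancel[OF N(1), of "t - s"] that by simp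
    then show False using N(2) by simp
  qed
  have char: "\<phi> x \<le> t \<longleftrightarrow> x - t *\<^sub>R e \<in> N" if "x \<in> ?I" for x t
  proof
    assume "\<phi> x \<le> t"
    then have "x - t *\<^sub>R e \<le> x - \<phi> x *\<^sub>R e" using e by (simp add: scaleR_right_mono)
    then show "x - t *\<^sub>R e \<in> N" using \<phi>(1)[OF that] sup_coneD(5)[OF N(1)] by blast
  next
    assume "x - t *\<^sub>R e \<in> N"
    then have "(\<phi> x *\<^sub>R e - x) + (x - t *\<^sub>R e) \<in> N" using \<phi>(2)[OF that] sup_coneD(2)[OF N(1)] by blast
    then show "\<phi> x \<le> t" by (intro le) (simp add: algebra_simps)
  qed
  have char': "t \<le> \<phi> x \<longleftrightarrow> t *\<^sub>R e - x \<in> N" if "x \<in> ?I" for x t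
  proof
    assume "t \<le> \<phi> x"
    then have "t *\<^sub>R e - x \<le> \<phi> x *\<^sub>R e - x" using e by (simp add: scaleR_right_mono)
    then show "t *\<^sub>R e - x \<in> N" using \<phi>(2)[OF that] sup_coneD(5)[OF N(1)] by blast
  next
    assume "t *\<^sub>R e - x \<in> N"
    then have "(t *\<^sub>R e - x) + (x - \<phi> x *\<^sub>R e) \<in> N" using \<phi>(1)[OF that] sup_coneD(2)[OF N(1)] by blast
    then show "t \<le> \<phi> x" by (intro le) (simp add: algebra_simps)
  qed
  have "real_lattice_hom e \<phi>"
    unfolding real_lattice_hom_def
  proof (intro conjI ballI allI)
    fix x y assume x: "x \<in> ?I" and y: "y \<in> ?I"
    note xy = principal_ideal_add[OF x y]
    show "\<phi> (x + y) = \<phi> x + \<phi> y"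
    proof (rule antisym)
      have "(x - \<phi> x *\<^sub>R e) + (y - \<phi> y *\<^sub>R e) \<in> N" using \<phi>(1) x y by (intro sup_coneD(2)[OF N(1)])
      then show "\<phi> (x + y) \<le> \<phi> x + \<phi> y" by (simp add: char[OF xy] algebra_simps)
      have "(\<phi> x *\<^sub>R e - x) + (\<phi> y *\<^sub>R e - y) \<in> N" using \<phi>(2) x y by (intro sup_coneD(2)[OF N(1)])
      then show "\<phi> x + \<phi> y \<le> \<phi> (x + y)" by (simp add: char'[OF xy] algebra_simps)
    qed
    note s = principal_ideal_sup[OF e x y]
    show "\<phi> (sup x y) = max (\<phi> x) (\<phi> y)"
    proof (rule antisym)
      let ?m = "max (\<phi> x) (\<phi> y)"
      have "x - ?m *\<^sub>R e \<in> N" "y - ?m *\<^sub>R e \<in> N"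
        using char[OF x, of ?m] char[OF y, of ?m] by simp_all
      then have "sup (x - ?m *\<^sub>R e) (y - ?m *\<^sub>R e) \<in> N" by (intro sup_coneD(3)[OF N(1)])
      then show "\<phi> (sup x y) \<le> ?m"
        by (simp add: char[OF s] diff_conv_add_uminus add_sup_distrib_right del: add_uminus_conv_diff)
      have "x - \<phi> (sup x y) *\<^sub>R e \<le> sup x y - \<phi> (sup x y) *\<^sub>R e"
        "y - \<phi> (sup x y) *\<^sub>R e \<le> sup x y - \<phi> (sup x y) *\<^sub>R e"
        by (simp_all add: diff_right_mono)
      then have "x - \<phi> (sup x y) *\<^sub>R e \<in> N" "y - \<phi> (sup x y) *\<^sub>R e \<in> N"
        using \<phi>(1)[OF s] sup_coneD(5)[OF N(1)] by blast+
      then show "?m \<le> \<phi> (sup x y)" by (simp add: char[OF x] char[OF y])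
    qed
  next
    fix c x assume x: "x \<in> ?I"
    note cx = principal_ideal_scaleR[OF x, of c]
    \<comment> \<open>For negative \<open>c\<close> the two defining memberships of \<phi> x
      exchange their roles.\<close>
    have "c *\<^sub>R x - (c * \<phi> x) *\<^sub>R e \<in> N \<and> (c * \<phi> x) *\<^sub>R e - c *\<^sub>R x \<in> N"
    proof (cases "0 \<le> c")
      case True
      then have "c *\<^sub>R (x - \<phi> x *\<^sub>R e) \<in> N" "c *\<^sub>R (\<phi> x *\<^sub>R e - x) \<in> N"
        using \<phi>[OF x] by (auto intro: sup_coneD(4)[OF N(1)])
      then show ?thesis by (simp add: algebra_simps)
    next
      case False
      then have "(- c) *\<^sub>R (x - \<phi> x *\<^sub>R e) \<in> N" "(- c) *\<^sub>R (\<phi> x *\<^sub>R e - x) \<in> N"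
        using \<phi>[OF x] by (intro sup_coneD(4)[OF N(1)]; simp)+
      then show ?thesis by (simp add: algebra_simps)
    qed
    then show "\<phi> (c *\<^sub>R x) = c * \<phi> x"
      by (intro antisym) (simp_all add: char[OF cx] char'[OF cx])
  qed
  then show ?thesis using char by (rule that)
qed

text \<open>Let \<rho> be the least coefficient with \<open>a\<close> below \<rho> times
  \<open>e\<close>; it is positive, as \<open>a\<close> is not below 0. The difference
  \<open>b\<close> is then nonpositive, and minimality of \<rho> allows \<open>- b\<close> to be
  adjoined to the negative cone without capturing \<open>e\<close>. A maximal cone containing
  \<open>- b\<close> yields \<phi> a \<ge> \<rho>.\<close>

lemma real_lattice_hom_separates:
  assumes e: "0 \<le> e" and a: "a \<in> principal_ideal e" and pos: "\<not> a \<le> 0"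
  obtains \<phi> where "real_lattice_hom e \<phi>" "0 < \<phi> a"
proof -
  define T where "T = {t. a \<le> t *\<^sub>R e}"
  have T0: "0 < t" if "t \<in> T" for t
  proof (rule ccontr)
    assume "\<not> 0 < t"
    then have "t *\<^sub>R e \<le> 0" using e by (simp add: scaleR_nonpos_nonneg)
    then show False using that pos order_trans unfolding T_def by blast
  qed
  obtain r where rT: "r \<in> T" using a by (auto simp: T_def elim: principal_idealE)
  have bdd: "bdd_below T" using T0 by (meson bdd_below.I less_imp_le)
  define \<rho> where "\<rho> = Inf T"
  define b where "b = a - \<rho> *\<^sub>R e"
  have le: "a \<le> \<rho> *\<^sub>R e"
  proof (rule archimedean_scaleR_le)
    fix \<epsilon> :: real assume "\<epsilon> > 0"
    then obtain t where t: "t \<in> T" "t < \<rho> + \<epsilon>"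
      using rT bdd cInf_less_iff[of T "\<rho> + \<epsilon>"] by (auto simp: \<rho>_def)
    then have "t *\<^sub>R e \<le> (\<rho> + \<epsilon>) *\<^sub>R e" using e by (intro scaleR_right_mono) auto
    then show "a \<le> \<rho> *\<^sub>R e + \<epsilon> *\<^sub>R e" using t by (auto simp: T_def scaleR_left_distrib)
  qed
  then have \<rho>: "0 < \<rho>" using T0 by (simp add: T_def)
  have c0: "sup_cone {x::'a. x \<le> 0}"
    unfolding sup_cone_def by (auto simp: scaleR_nonneg_nonpos add_nonpos_nonpos intro: order_trans)
  have b0: "b \<in> {x. x \<le> 0}" using le by (simp add: b_def)
  let ?N0 = "adjoin_neg {x. x \<le> 0} b"
  have "e \<notin> ?N0"
  proof
    assume "e \<in> ?N0"
    then obtain n t where h: "n \<le> 0" "0 \<le> t" "e \<le> n - t *\<^sub>R b" by (auto simp: adjoin_neg_def)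
    have et: "e + t *\<^sub>R b \<le> 0" using h by (metis le_diff_eq order_trans)
    show False
    proof (cases "t = 0")
      case True
      then have "e = 0" using et e by simp
      then show False using le pos by simp
    next
      case False
      then have "inverse t *\<^sub>R (e + t *\<^sub>R b) \<le> 0" using et h by (intro scaleR_nonneg_nonpos) auto
      then have "a \<le> (\<rho> - inverse t) *\<^sub>R e" using False by (simp add: b_def algebra_simps)
      then have "\<rho> \<le> \<rho> - inverse t" using bdd unfolding \<rho>_def by (intro cInf_lower) (auto simp: T_def)
      then show False using False h by simp
    qed
  qed
  then obtain N where N: "?N0 \<subseteq> N" "sup_cone N" "e \<notin> N"
    "\<forall>N'. sup_cone N' \<and> e \<notin> N' \<and> N \<subseteq> N' \<longrightarrow> N' = N"
    using maximal_sup_cone[OF sup_cone_adjoin_neg[OF c0 b0]] by metis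
  obtain \<phi> where \<phi>: "real_lattice_hom e \<phi>"
    "\<And>x t. x \<in> principal_ideal e \<Longrightarrow> \<phi> x \<le> t \<longleftrightarrow> x - t *\<^sub>R e \<in> N"
    using maximal_sup_cone_hom[OF e N(2-4)] by metis
  have "- b \<in> N" using neg_in_adjoin_neg[OF c0] N(1) by blast
  then have "\<phi> (- a) \<le> - \<rho>"
    using \<phi>(2)[OF principal_ideal_uminus[OF a], of "- \<rho>"] by (simp add: b_def algebra_simps)
  moreover have "\<phi> (- a) = - \<phi> a"
    using \<phi>(1) a scaleR_minus1_left[of a] unfolding real_lattice_hom_def by (metis mult_minus1)
  ultimately show ?thesis using that \<phi>(1) \<rho> by simp
qed

section \<open>Pointwise calculus with homomorphisms\<close>

lemma
  assumes e: "0 \<le> e" and h: "real_lattice_hom e \<phi>"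
    and x: "x \<in> principal_ideal e" and y: "y \<in> principal_ideal e"
  shows hom_add: "\<phi> (x + y) = \<phi> x + \<phi> y"
    and hom_sup: "\<phi> (sup x y) = max (\<phi> x) (\<phi> y)"
    and hom_scaleR: "\<phi> (c *\<^sub>R x) = c * \<phi> x"
    and hom_diff: "\<phi> (x - y) = \<phi> x - \<phi> y"
    and hom_inf: "\<phi> (inf x y) = min (\<phi> x) (\<phi> y)"
    and hom_mono: "x \<le> y \<Longrightarrow> \<phi> x \<le> \<phi> y"
    and hom_zero: "\<phi> 0 = 0"
proof -
  have add: "\<phi> (a + b) = \<phi> a + \<phi> b" and sup: "\<phi> (sup a b) = max (\<phi> a) (\<phi> b)"
    if "a \<in> principal_ideal e" "b \<in> principal_ideal e" for a b
    using h that by (auto simp: real_lattice_hom_def)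
  have scale: "\<phi> (c *\<^sub>R a) = c * \<phi> a" if "a \<in> principal_ideal e" for a c
    using h that by (auto simp: real_lattice_hom_def)
  have minus: "\<phi> (- a) = - \<phi> a" if "a \<in> principal_ideal e" for a
    using scale[OF that, of "- 1"] by simp
  show "\<phi> (x + y) = \<phi> x + \<phi> y" "\<phi> (sup x y) = max (\<phi> x) (\<phi> y)" "\<phi> (c *\<^sub>R x) = c * \<phi> x"
    using x y by (auto intro: add sup scale)
  show "\<phi> (x - y) = \<phi> x - \<phi> y"
    using add[OF x principal_ideal_uminus[OF y]] minus[OF y] by simp
  show "\<phi> (inf x y) = min (\<phi> x) (\<phi> y)"
  proof -
    have m: "- x \<in> principal_ideal e" "- y \<in> principal_ideal e"
      using x y by (auto intro: principal_ideal_uminus)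
    have "\<phi> (inf x y) = - \<phi> (sup (- x) (- y))"
      unfolding inf_eq_neg_sup by (intro minus principal_ideal_sup e m)
    also have "\<dots> = - max (- \<phi> x) (- \<phi> y)" using sup[OF m] x y by (simp add: minus)
    finally show ?thesis by simp
  qed
  show "\<phi> x \<le> \<phi> y" if "x \<le> y" using sup[OF x y] that by (simp add: sup_absorb2)
  show "\<phi> 0 = 0" using scale[OF x, of 0] by simp
qed

lemma hom_sum:
  assumes "0 \<le> e" "real_lattice_hom e \<phi>" "finite J" "\<And>j. j \<in> J \<Longrightarrow> f j \<in> principal_ideal e"
  shows "\<phi> (\<Sum>j\<in>J. f j) = (\<Sum>j\<in>J. \<phi> (f j))"
  using assms(3,4)
proof (induction J rule: finite_induct)
  case empty
  show ?case using hom_zero[OF assms(1,2)] principal_ideal_zero[OF assms(1)] by auto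
next
  case (insert j J)
  then have "sum f J \<in> principal_ideal e" by (intro principal_ideal_sum assms(1)) auto
  then show ?case using insert hom_add[OF assms(1,2)] by simp
qed

text \<open>This transfers inequalities between real numbers to the lattice: if \<open>x - y\<close>
  were not below 0, some homomorphism would be positive on it.\<close>

lemma le_if_hom_le:
  assumes e: "0 \<le> e" and x: "x \<in> principal_ideal e" and y: "y \<in> principal_ideal e"
    and le: "\<And>\<phi>. real_lattice_hom e \<phi> \<Longrightarrow> \<phi> x \<le> \<phi> y"
  shows "x \<le> y"
proof (rule ccontr)
  assume "\<not> x \<le> y"
  then have "\<not> x - y \<le> 0" by simp
  then obtain \<phi> where \<phi>: "real_lattice_hom e \<phi>" "0 < \<phi> (x - y)"
    using real_lattice_hom_separates[OF e principal_ideal_diff[OF x y]] by blast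
  then show False using le[OF \<phi>(1)] hom_diff[OF e \<phi>(1) x y] by simp
qed

section \<open>Approximate truncation in a complex Banach lattice\<close>

text \<open>The \<open>j\<close>-th summand is the length of the part of the interval from
  \<open>j\<close> to \<open>j + 1\<close> that lies below \<tau>.\<close>

lemma sum_clipped: "0 \<le> \<tau> \<Longrightarrow> (\<Sum>j<k. min 1 (max 0 (\<tau> - real j))) = min (real k) \<tau>"
  by (induction k) auto

text \<open>Approximates \<open>x s / m\<close> by lattice operations: in the real line the \<open>j\<close>-th summand is close to
  \<open>s\<close> if \<open>x / m > j / n - 1\<close> and to \<open>0\<close> otherwise, so that the sum over \<open>j\<close> is close to
  \<open>n (x / m + 1) s\<close>.\<close>

definition damp :: "nat \<Rightarrow> 'a::real_banach_lattice \<Rightarrow> 'a \<Rightarrow> 'a \<Rightarrow> 'a" where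
  "damp n m s x =
    (1 / n) *\<^sub>R (\<Sum>j<2 * n. inf s (real n *\<^sub>R sup 0 (x - (real j / real n - 1) *\<^sub>R m))) - s"

definition damp_real :: "nat \<Rightarrow> real \<Rightarrow> real \<Rightarrow> real \<Rightarrow> real" where
  "damp_real n m s x = (1 / n) * (\<Sum>j<2 * n. min s (real n * max 0 (x - (real j / real n - 1) * m))) - s"

text \<open>With \<tau> = n (r + 1) the \<open>j\<close>-th summand is the minimum of
  \<open>s\<close> and \<open>m max 0 (\<tau> - j)\<close>. As \<open>s \<le> m\<close>, it is at
  least \<open>s\<close> times the clipped value of \<tau> - j; it is at most \<open>s\<close> times
  the clipped value of \<tau> + 1 - j, since it vanishes unless j < \<tau>. By
  \<open>sum_clipped\<close> the sum lies between s \<tau> and s (\<tau> + 1); the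
  \<open>2 * n\<close> summands suffice because \<tau> \<le> 2 n.\<close>

lemma damp_real_bounds:
  assumes n: "0 < n" and s: "0 \<le> s" "s \<le> m" and r: "\<bar>r\<bar> \<le> 1"
  shows "r * s \<le> damp_real n m s (r * m)" "damp_real n m s (r * m) \<le> r * s + s / n"
proof -
  define \<tau> where "\<tau> = n * (r + 1)"
  have \<tau>: "0 \<le> \<tau>" "\<tau> \<le> real (2 * n)" using r n by (auto simp: \<tau>_def abs_le_iff)
  have summand: "n * max 0 (r * m - (j / n - 1) * m) = m * max 0 (\<tau> - j)" for j :: nat
  proof -
    have "n * max 0 (r * m - (j / n - 1) * m) = max 0 (n * (r * m - (j / n - 1) * m))"
      using n by (simp add: max_mult_distrib_left)
    also have "n * (r * m - (j / n - 1) * m) = m * (\<tau> - j)"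
      using n by (simp add: \<tau>_def field_simps)
    also have "max 0 (m * (\<tau> - j)) = m * max 0 (\<tau> - j)"
      using s by (simp add: max_mult_distrib_left)
    finally show ?thesis .
  qed
  define \<Sigma> where "\<Sigma> = (\<Sum>j<2 * n. min s (m * max 0 (\<tau> - real j)))"
  have D: "damp_real n m s (r * m) = (1 / n) * \<Sigma> - s"
    unfolding damp_real_def \<Sigma>_def summand ..
  have "s * \<tau> = (\<Sum>j<2 * n. s * min 1 (max 0 (\<tau> - real j)))"
    using \<tau> by (simp add: sum_clipped flip: sum_distrib_left)
  also have "\<dots> \<le> \<Sigma>"
    unfolding \<Sigma>_def
  proof (rule sum_mono)
    fix j
    have "s * min 1 (max 0 (\<tau> - real j)) \<le> s * 1" using s by (intro mult_left_mono) auto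
    moreover have "s * min 1 (max 0 (\<tau> - real j)) \<le> m * max 0 (\<tau> - real j)"
      using s by (intro mult_mono) auto
    ultimately show "s * min 1 (max 0 (\<tau> - real j)) \<le> min s (m * max 0 (\<tau> - real j))" by simp
  qed
  finally have lower: "s * \<tau> \<le> \<Sigma>" .
  have "\<Sigma> \<le> (\<Sum>j<2 * n. s * min 1 (max 0 ((\<tau> + 1) - real j)))"
    unfolding \<Sigma>_def
  proof (rule sum_mono)
    fix j
    show "min s (m * max 0 (\<tau> - real j)) \<le> s * min 1 (max 0 ((\<tau> + 1) - real j))"
    proof (cases "\<tau> \<le> real j")
      case True
      then have "min s (m * max 0 (\<tau> - real j)) = 0" using s by simp
      then show ?thesis using s by simp
    qed simp
  qed
  also have "\<dots> = s * min (real (2 * n)) (\<tau> + 1)"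
    using \<tau> sum_clipped[of "\<tau> + 1" "2 * n"] by (simp flip: sum_distrib_left)
  also have "\<dots> \<le> s * (\<tau> + 1)" using s by (intro mult_left_mono) auto
  finally have upper: "\<Sigma> \<le> s * (\<tau> + 1)" .
  have "(1 / n) * (s * \<tau>) \<le> (1 / n) * \<Sigma>" "(1 / n) * \<Sigma> \<le> (1 / n) * (s * (\<tau> + 1))"
    using lower upper n by (intro mult_left_mono; simp)+
  moreover have "(1 / n) * (s * \<tau>) = r * s + s" "(1 / n) * (s * (\<tau> + 1)) = r * s + s + s / n"
    using n by (simp_all add: \<tau>_def field_simps)
  ultimately show "r * s \<le> damp_real n m s (r * m)" "damp_real n m s (r * m) \<le> r * s + s / n"
    unfolding D by linarith+
qed

text \<open>With \<open>x = p m\<close> and \<open>y = q m\<close>, the damped pair is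
  \<open>(p s, q s)\<close> up to \<open>s / n\<close> in each coordinate, where
  \<open>s = min m u\<close>. A rotated real part of \<open>(p, q)\<close> is at most 1, so the two
  bounds are \<open>s + 2 s / n\<close>, at most \<open>3 u\<close>, and
  \<open>(m - s) + 2 s / n\<close>, where \<open>m - s\<close> is the excess of \<open>m\<close>
  over \<open>u\<close>.\<close>

lemma rotation_damp_real_bounds:
  assumes n: "0 < n" and u: "0 \<le> u" and m: "cmod (Complex x y) \<le> m"
  defines "d \<equiv> damp_real n m (min m u)"
  shows "cos \<theta> * d x - sin \<theta> * d y \<le> 3 * u"
    and "cos \<theta> * (x - d x) - sin \<theta> * (y - d y) \<le> max (m - u) 0 + 2 / n * m"
proof -
  define s where "s = min m u"
  have m0: "0 \<le> m" using m norm_ge_zero order_trans by blast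
  have s: "0 \<le> s" "s \<le> m" "s \<le> u" using m0 u by (auto simp: s_def)
  \<comment> \<open>Dividing by \<open>m\<close> is confined to this step; for \<open>m = 0\<close>
    both coordinates vanish and \<open>p = q = 0\<close> serves.\<close>
  obtain p q where pq: "x = p * m" "y = q * m" "cmod (Complex p q) \<le> 1"
  proof (cases "m = 0")
    case True
    then have "Complex x y = 0" using m by simp
    then show ?thesis using True that[of 0 0] by (simp add: complex_eq_iff cmod_def)
  next
    case False
    have "Complex x y = complex_of_real m * Complex (x / m) (y / m)"
      using False by (simp add: complex_eq_iff)
    then have "cmod (Complex x y) = m * cmod (Complex (x / m) (y / m))"
      using m0 by (simp add: norm_mult)
    then have "cmod (Complex (x / m) (y / m)) \<le> 1" using m m0 False by simp
    then show ?thesis using that[of "x / m" "y / m"] False by simp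
  qed
  have "\<bar>p\<bar> \<le> 1" "\<bar>q\<bar> \<le> 1"
    using pq(3) abs_Re_le_cmod[of "Complex p q"] abs_Im_le_cmod[of "Complex p q"] by simp_all
  then have "p * s \<le> d x" "d x \<le> p * s + s / n" "q * s \<le> d y" "d y \<le> q * s + s / n"
    unfolding d_def pq(1,2) s_def[symmetric] by (auto intro: damp_real_bounds n s)
  then obtain \<alpha> \<beta> where d: "d x = p * s + \<alpha>" "d y = q * s + \<beta>" "\<bar>\<alpha>\<bar> \<le> s / n" "\<bar>\<beta>\<bar> \<le> s / n"
    by (intro that[of "d x - p * s" "d y - q * s"]) auto
  define k where "k = cos \<theta> * p - sin \<theta> * q"
  have "k = Re (cis \<theta> * Complex p q)" by (simp add: k_def)
  also have "\<dots> \<le> 1" using complex_Re_le_cmod[of "cis \<theta> * Complex p q"] pq(3) by (simp add: norm_mult)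
  finally have k: "k \<le> 1" .
  define \<gamma> where "\<gamma> = cos \<theta> * \<alpha> - sin \<theta> * \<beta>"
  have "\<bar>cos \<theta> * \<alpha>\<bar> \<le> 1 * (s / n)" "\<bar>sin \<theta> * \<beta>\<bar> \<le> 1 * (s / n)"
    unfolding abs_mult using d s by (intro mult_mono; simp)+
  then have \<gamma>: "\<bar>\<gamma>\<bar> \<le> 2 * (s / n)" unfolding \<gamma>_def by linarith
  have sn: "s / n \<le> s" using s n by (simp add: divide_le_eq mult_le_cancel_left1)
  have "k * s \<le> 1 * s" using k s by (intro mult_right_mono) auto
  moreover have "cos \<theta> * d x - sin \<theta> * d y = k * s + \<gamma>"
    by (simp add: d k_def \<gamma>_def algebra_simps)
  ultimately show "cos \<theta> * d x - sin \<theta> * d y \<le> 3 * u" using \<gamma> sn s by linarith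
  have "cos \<theta> * (x - d x) - sin \<theta> * (y - d y) = k * (m - s) + - \<gamma>"
    unfolding d unfolding pq by (simp add: k_def \<gamma>_def algebra_simps)
  also have "\<dots> \<le> 1 * (m - s) + 2 / n * m"
  proof (intro add_mono mult_right_mono k)
    have "- \<gamma> \<le> 2 * (s / n)" using \<gamma> by linarith
    also have "\<dots> \<le> 2 / n * m" using s n by (simp add: field_simps)
    finally show "- \<gamma> \<le> 2 / n * m" .
  qed (use s in simp)
  also have "m - s = max (m - u) 0" by (simp add: s_def)
  finally show "cos \<theta> * (x - d x) - sin \<theta> * (y - d y) \<le> max (m - u) 0 + 2 / n * m"
    by simp
qed

text \<open>Take for \<open>c\<close> the damped real and imaginary parts of \<open>z\<close>. By
  \<open>modulus_least\<close> it suffices to bound each rotated real part, and these all lie in the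
  ideal of \<open>modulus z + u\<close>. A homomorphism commutes with \<open>damp\<close>, so
  \<open>rotation_damp_real_bounds\<close> and \<open>le_if_hom_le\<close> finish.\<close>

lemma truncation_approx:
  fixes z :: "'a::real_banach_lattice complexification"
  assumes n: "0 < n" and u: "0 \<le> u"
  obtains c where "modulus c \<le> 3 *\<^sub>R u"
    "modulus (z - c) \<le> sup (modulus z - u) 0 + (2 / real n) *\<^sub>R modulus z"
proof -
  define m where "m = modulus z"
  define s where "s = inf m u"
  define e where "e = m + u"
  have m0: "0 \<le> m" by (simp add: m_def modulus_nonneg)
  have e: "0 \<le> e" using m0 u by (simp add: e_def)
  let ?I = "principal_ideal e"
  have I: "w \<in> ?I" if "\<bar>w\<bar> \<le> e" for w
    using that by (auto simp: principal_ideal_def intro!: exI[of _ 1])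
  have mI: "m \<in> ?I" and uI: "u \<in> ?I" using m0 u unfolding e_def[symmetric]
    by (intro I; simp add: e_def)+
  have "m \<le> e" using u by (simp add: e_def)
  then have xI: "rpart z \<in> ?I" and yI: "ipart z \<in> ?I"
    using abs_rpart_le_modulus[of z] abs_ipart_le_modulus[of z] unfolding m_def
    by (auto intro: I order_trans)
  have sI: "s \<in> ?I" unfolding s_def by (intro principal_ideal_inf e mI uI)
  note closed = principal_ideal_diff principal_ideal_scaleR principal_ideal_inf[OF e]
    principal_ideal_sup[OF e] principal_ideal_zero[OF e] principal_ideal_add
    principal_ideal_sum[OF finite_lessThan e]
  have dampI: "damp n m s w \<in> ?I" if "w \<in> ?I" for w
    unfolding damp_def by (intro closed that mI sI)
  have damp: "\<phi> (damp n m s w) = damp_real n (\<phi> m) (min (\<phi> m) (\<phi> u)) (\<phi> w)"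
    if "real_lattice_hom e \<phi>" "w \<in> ?I" for \<phi> w
    using that(2) mI sI hom_inf[OF e that(1) mI uI] unfolding damp_def damp_real_def s_def[symmetric]
    by (simp add: hom_diff[OF e that(1)] hom_scaleR[OF e that(1)] hom_inf[OF e that(1)]
        hom_sup[OF e that(1)] hom_zero[OF e that(1) mI mI] hom_sum[OF e that(1)] closed)
  \<comment> \<open>Rotating by minus the argument turns the absolute value of the pair into \<phi>
    of a rotated real part of \<open>z\<close>, which the modulus dominates.\<close>
  have modz: "cmod (Complex (\<phi> (rpart z)) (\<phi> (ipart z))) \<le> \<phi> m" if h: "real_lattice_hom e \<phi>" for \<phi>
  proof -
    let ?w = "Complex (\<phi> (rpart z)) (\<phi> (ipart z))"
    define r where "r = cmod ?w"
    define \<alpha> where "\<alpha> = Arg ?w"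
    have "?w = rcis r \<alpha>" by (simp add: r_def \<alpha>_def rcis_cmod_Arg)
    then have w: "\<phi> (rpart z) = r * cos \<alpha>" "\<phi> (ipart z) = r * sin \<alpha>"
      by (simp_all add: complex_eq_iff)
    have "r = r * ((sin \<alpha>)\<^sup>2 + (cos \<alpha>)\<^sup>2)" by simp
    also have "\<dots> = cos \<alpha> * \<phi> (rpart z) + sin \<alpha> * \<phi> (ipart z)"
      unfolding w power2_eq_square by (simp only: algebra_simps)
    finally have "r = cos \<alpha> * \<phi> (rpart z) + sin \<alpha> * \<phi> (ipart z)" .
    also have "\<dots> = \<phi> (rpart (cscale (cis (- \<alpha>)) z))"
      using xI yI by (simp add: cscale_def hom_add[OF e h] hom_scaleR[OF e h] closed)
    also have "\<dots> \<le> \<phi> m"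
      using xI yI mI modulus_upper[of "- \<alpha>" z]
      by (intro hom_mono[OF e h]) (auto simp: cscale_def m_def closed)
    finally show ?thesis by (simp add: r_def)
  qed
  define c where "c = Cplx (damp n m s (rpart z)) (damp n m s (ipart z))"
  have cI: "rpart c \<in> ?I" "ipart c \<in> ?I" by (auto simp: c_def dampI xI yI)
  have u_hom: "0 \<le> \<phi> u" if "real_lattice_hom e \<phi>" for \<phi>
    using hom_mono[OF e that _ uI u] hom_zero[OF e that uI uI] principal_ideal_zero[OF e] by simp
  show ?thesis
  proof (rule that[of c])
    show "modulus c \<le> 3 *\<^sub>R u"
    proof (intro modulus_least le_if_hom_le[OF e])
      fix \<theta> \<phi> assume h: "real_lattice_hom e \<phi>"
      have "\<phi> (rpart (cscale (cis \<theta>) c)) = cos \<theta> * \<phi> (rpart c) - sin \<theta> * \<phi> (ipart c)"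
        using cI by (simp add: cscale_def hom_diff[OF e h] hom_scaleR[OF e h] closed)
      also have "\<dots> \<le> 3 * \<phi> u"
        using rotation_damp_real_bounds(1)[OF n u_hom[OF h] modz[OF h]]
        by (simp add: c_def damp[OF h] xI yI)
      finally show "\<phi> (rpart (cscale (cis \<theta>) c)) \<le> \<phi> (3 *\<^sub>R u)"
        using uI by (simp add: hom_scaleR[OF e h])
    qed (use cI uI in \<open>auto simp: cscale_def closed\<close>)
    show "modulus (z - c) \<le> sup (modulus z - u) 0 + (2 / real n) *\<^sub>R modulus z"
      unfolding m_def[symmetric]
    proof (intro modulus_least le_if_hom_le[OF e])
      fix \<theta> \<phi> assume h: "real_lattice_hom e \<phi>"
      have "\<phi> (rpart (cscale (cis \<theta>) (z - c)))
          = cos \<theta> * (\<phi> (rpart z) - \<phi> (rpart c)) - sin \<theta> * (\<phi> (ipart z) - \<phi> (ipart c))"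
        using cI xI yI by (simp add: cscale_def hom_diff[OF e h] hom_scaleR[OF e h] closed)
      also have "\<dots> \<le> max (\<phi> m - \<phi> u) 0 + 2 / n * \<phi> m"
        using rotation_damp_real_bounds(2)[OF n u_hom[OF h] modz[OF h]]
        by (simp add: c_def damp[OF h] xI yI)
      also have "\<dots> = \<phi> (sup (m - u) 0 + (2 / n) *\<^sub>R m)"
        using mI uI by (simp add: hom_add[OF e h] hom_sup[OF e h] hom_diff[OF e h]
            hom_scaleR[OF e h] hom_zero[OF e h mI mI] closed)
      finally show "\<phi> (rpart (cscale (cis \<theta>) (z - c))) \<le> \<phi> (sup (m - u) 0 + (2 / n) *\<^sub>R m)" .
    qed (use cI xI yI mI uI in \<open>auto simp: cscale_def intro!: closed\<close>)
  qed
qed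

section \<open>Comparison of the two set functions\<close>

text \<open>The sum of the moduli of the centres dominates each of them, so every centre lies in a
  single order interval and the ball supplies the remainder.\<close>

lemma chi_cover_imp_rho_cover:
  fixes A :: "'a::real_banach_lattice complexification set"
  assumes "0 < \<delta>" "finite C" "A \<subseteq> (\<Union>c\<in>C. cball c \<delta>)"
  shows "\<exists>u\<ge>0. A \<subseteq> {a + \<delta> *\<^sub>R b | a b. a \<in> order_interval u \<and> b \<in> cball 0 1}"
proof (intro exI conjI subsetI)
  let ?u = "\<Sum>c\<in>C. modulus c"
  show "0 \<le> ?u" by (intro sum_nonneg modulus_nonneg)
  fix w assume "w \<in> A"
  then obtain c where c: "c \<in> C" "dist c w \<le> \<delta>" using assms(3) by auto
  have "modulus c \<le> ?u" using sum.remove[OF assms(2) c(1), of modulus] by (simp add: sum_nonneg modulus_nonneg)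
  moreover have "norm ((1 / \<delta>) *\<^sub>R (w - c)) \<le> 1"
    using c assms(1) by (simp add: dist_norm norm_minus_commute divide_le_eq)
  moreover have "w = c + \<delta> *\<^sub>R ((1 / \<delta>) *\<^sub>R (w - c))" using assms(1) by simp
  ultimately show "w \<in> {a + \<delta> *\<^sub>R b | a b. a \<in> order_interval ?u \<and> b \<in> cball 0 1}"
    unfolding order_interval_def mem_cball_0 by blast
qed

text \<open>As \<open>modulus a\<close> is at most \<open>u\<close>, the excess over
  \<open>u\<close> is dominated by the modulus of the ball term. In this form the covering by
  \<open>[-u, u]\<close> plus a ball enters the estimates.\<close>

lemma norm_excess_le:
  fixes a b :: "'a::real_banach_lattice complexification"
  assumes "a \<in> order_interval u" "b \<in> cball 0 1" "0 < \<delta>"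
  shows "norm (sup (modulus (a + \<delta> *\<^sub>R b) - u) 0) \<le> \<delta>"
proof -
  have "modulus (a + \<delta> *\<^sub>R b) \<le> modulus a + modulus (\<delta> *\<^sub>R b)" by (rule modulus_triangle)
  also have "\<dots> \<le> u + modulus (\<delta> *\<^sub>R b)" using assms(1) by (simp add: order_interval_def)
  finally have "sup (modulus (a + \<delta> *\<^sub>R b) - u) 0 \<le> modulus (\<delta> *\<^sub>R b)"
    by (simp add: modulus_nonneg algebra_simps)
  then have "norm (sup (modulus (a + \<delta> *\<^sub>R b) - u) 0) \<le> norm (\<delta> *\<^sub>R b)"
    unfolding norm_complexification_def by (intro norm_mono_nonneg) auto
  also have "\<dots> \<le> \<delta>" using assms(2,3) by simp
  finally show ?thesis .
qed

text \<open>Where \<open>|w - a|\<close> is small compared with \<open>u\<close>, \<open>|w - c|\<close> is controlled by the excess of \<open>|w|\<close>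
  over \<open>u\<close> through \<open>a\<close>; where it is large, it is controlled trivially by \<open>|w| + |c|\<close>.\<close>

lemma norm_diff_truncation_le:
  fixes w a c :: "'a::real_banach_lattice complexification"
  assumes u: "0 \<le> u" and h: "0 \<le> h" and c: "modulus c \<le> 3 *\<^sub>R u"
    and ac: "modulus (a - c) \<le> sup (modulus a - u) 0 + h"
  shows "norm (w - c)
    \<le> norm (sup (modulus w - u) 0) + norm h + 4 * norm (inf (modulus (w - a)) u)"
proof -
  define p where "p = sup (modulus w - u) 0"
  define d where "d = modulus (w - a)"
  have d0: "0 \<le> d" by (simp add: d_def modulus_nonneg)
  have p0: "0 \<le> p" "modulus w \<le> p + u" by (simp_all add: p_def flip: diff_le_eq)
  have "modulus a \<le> modulus w + d"
    using modulus_triangle[of w "a - w"] modulus_minus[of "a - w"] by (simp add: d_def)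
  also have "\<dots> \<le> p + u + d" using p0 by simp
  finally have a: "sup (modulus a - u) 0 \<le> p + d" using p0 d0 by (simp add: algebra_simps)
  have "modulus (w - c) \<le> d + modulus (a - c)"
    using modulus_triangle[of "w - a" "a - c"] by (simp add: d_def)
  also have "\<dots> \<le> d + ((p + d) + h)" using ac a by (meson add_left_mono add_right_mono order_trans)
  also have "\<dots> = p + h + 2 *\<^sub>R d" by (simp add: scaleR_2)
  \<comment> \<open>The factor is enlarged to match the 4 = 1 + 3 that the bounds on
    \<open>modulus w\<close> and \<open>modulus c\<close> produce below.\<close>
  also have "\<dots> \<le> p + h + 4 *\<^sub>R d" using d0 by (intro add_left_mono scaleR_right_mono) auto
  finally have 1: "modulus (w - c) - (p + h) \<le> 4 *\<^sub>R d" by (simp add: algebra_simps)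
  have "modulus (w - c) \<le> modulus w + modulus c"
    using modulus_triangle[of w "- c"] by (simp add: modulus_minus)
  also have "\<dots> \<le> (p + u) + 3 *\<^sub>R u" using p0 c by (intro add_mono)
  also have "\<dots> = p + 4 *\<^sub>R u" using scaleR_left_distrib[of 1 3 u] by simp
  also have "\<dots> \<le> p + h + 4 *\<^sub>R u" using h by simp
  finally have 2: "modulus (w - c) - (p + h) \<le> 4 *\<^sub>R u" by (simp add: algebra_simps)
  \<comment> \<open>Both bounds now carry the same factor; removing it lets \<open>inf d u\<close>
    be formed.\<close>
  have "(1 / 4) *\<^sub>R (modulus (w - c) - (p + h)) \<le> (1 / 4) *\<^sub>R (4 *\<^sub>R d)"
    "(1 / 4) *\<^sub>R (modulus (w - c) - (p + h)) \<le> (1 / 4) *\<^sub>R (4 *\<^sub>R u)"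
    using 1 2 by (intro scaleR_left_mono; simp)+
  then have "(1 / 4) *\<^sub>R (modulus (w - c) - (p + h)) \<le> inf d u" by simp
  then have "4 *\<^sub>R ((1 / 4) *\<^sub>R (modulus (w - c) - (p + h))) \<le> 4 *\<^sub>R inf d u"
    by (intro scaleR_left_mono) auto
  then have "modulus (w - c) \<le> p + h + 4 *\<^sub>R inf d u" by (simp add: algebra_simps)
  then have "norm (w - c) \<le> norm (p + h + 4 *\<^sub>R inf d u)"
    unfolding norm_complexification_def by (intro norm_mono_nonneg modulus_nonneg)
  also have "\<dots> \<le> norm p + norm h + norm (4 *\<^sub>R inf d u)"
    by (intro norm_triangle_le add_right_mono norm_triangle_ineq)
  finally show ?thesis by (simp add: p_def d_def)
qed

text \<open>The neighbourhoods \<open>V a\<close> test against the single element \<open>u\<close>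
  that bounds the order interval. Compactness leaves finitely many \<open>a\<close>, and their
  approximate truncations are the centres of the balls.\<close>

lemma rho_cover_imp_chi_cover:
  fixes A :: "'a::real_banach_lattice complexification set"
  assumes A: "d_compact A" and \<delta>: "0 < \<delta>" and \<eta>: "0 < \<eta>" and u: "0 \<le> u"
    and cov: "A \<subseteq> {a + \<delta> *\<^sub>R b | a b. a \<in> order_interval u \<and> b \<in> cball 0 1}"
  shows "\<exists>C. finite C \<and> A \<subseteq> (\<Union>c\<in>C. cball c (\<delta> + \<eta>))"
proof -
  have "\<exists>c h. modulus c \<le> 3 *\<^sub>R u \<and> 0 \<le> h \<and> norm h \<le> \<eta> / 2 \<and>
      modulus (a - c) \<le> sup (modulus a - u) 0 + h" for a :: "'a complexification"
  proof -
    \<comment> \<open>Chosen so that the truncation error \<open>(2 / n) norm a\<close> is at most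
      \<eta> / 2.\<close>
    obtain n :: nat where n: "4 * norm a / \<eta> < n" using reals_Archimedean2 by blast
    moreover have "0 \<le> 4 * norm a / \<eta>" using \<eta> by simp
    ultimately have n0: "0 < n" using of_nat_0_less_iff[of n, where ?'a = real] by linarith
    obtain c where c: "modulus c \<le> 3 *\<^sub>R u"
      "modulus (a - c) \<le> sup (modulus a - u) 0 + (2 / real n) *\<^sub>R modulus a"
      using truncation_approx[OF n0 u, of a] by blast
    have "norm ((2 / real n) *\<^sub>R modulus a) = 2 / real n * norm a"
      by (simp add: norm_complexification_def)
    also have "\<dots> \<le> \<eta> / 2" using n n0 \<eta> by (simp add: field_simps)
    finally show ?thesis
      using c by (intro exI[of _ c] exI[of _ "(2 / real n) *\<^sub>R modulus a"])
        (auto simp: modulus_nonneg scaleR_nonneg_nonneg)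
  qed
  then obtain c h where ch: "\<And>a. modulus (c a) \<le> 3 *\<^sub>R u" "\<And>a. 0 \<le> h a" "\<And>a. norm (h a) \<le> \<eta> / 2"
      "\<And>a :: 'a complexification. modulus (a - c a) \<le> sup (modulus a - u) 0 + h a"
    by metis
  \<comment> \<open>The factor 4 of \<open>norm_diff_truncation_le\<close> turns \<eta> / 8 into the
    remaining \<eta> / 2.\<close>
  define V where "V = (\<lambda>a. {w. norm (inf (modulus (w - a)) u) < \<eta> / 8})"
  have "a \<in> V a" for a
    using u \<eta> modulus_eq_0_iff[of "0 :: 'a complexification"] by (simp add: V_def inf_absorb1)
  then have "A \<subseteq> \<Union>(V ` A)" by blast
  moreover have "\<And>U. U \<in> V ` A \<Longrightarrow> openin d_topology U"
    unfolding V_def openin_d_topology using d_open_basic[OF u] by blast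
  ultimately obtain \<F> where \<F>: "finite \<F>" "\<F> \<subseteq> V ` A" "A \<subseteq> \<Union>\<F>"
    using A unfolding compactin_def by blast
  then obtain F where F: "finite F" "F \<subseteq> A" "\<F> = V ` F" by (meson finite_subset_image)
  have "A \<subseteq> (\<Union>a\<in>c ` F. cball a (\<delta> + \<eta>))"
  proof
    fix w assume w: "w \<in> A"
    then obtain a where a: "a \<in> F" "norm (inf (modulus (w - a)) u) < \<eta> / 8"
      using \<F>(3) F(3) by (auto simp: V_def)
    have "norm (sup (modulus w - u) 0) \<le> \<delta>" using w cov norm_excess_le[OF _ _ \<delta>] by blast
    then have "norm (w - c a) \<le> \<delta> + \<eta>"
      using norm_diff_truncation_le[OF u ch(2)[of a] ch(1)[of a] ch(4)[of a], of w] ch(3)[of a] a(2)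
      by linarith
    then show "w \<in> (\<Union>a\<in>c ` F. cball a (\<delta> + \<eta>))"
      using a(1) by (auto simp: dist_norm norm_minus_commute)
  qed
  then show ?thesis using F(1) by blast
qed

theorem proposition18:
  fixes A :: "'a::real_banach_lattice complexification set"
  assumes "bounded A" and "d_compact A"
  shows "chi A = rho A"
proof -
  define X where "X = {\<delta>. 0 < \<delta> \<and> (\<exists>C. finite C \<and> A \<subseteq> (\<Union>c\<in>C. cball c \<delta>))}"
  define R where "R = {\<delta>. 0 < \<delta> \<and>
    (\<exists>u\<ge>0. A \<subseteq> {a + \<delta> *\<^sub>R b | a b. a \<in> order_interval u \<and> b \<in> cball 0 1})}"
  have XR: "X \<subseteq> R" unfolding X_def R_def using chi_cover_imp_rho_cover by blast
  obtain r where r: "0 < r" "\<And>w. w \<in> A \<Longrightarrow> norm w \<le> r" using assms(1) by (auto simp: bounded_pos)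
  \<comment> \<open>Boundedness makes \<open>X\<close> nonempty, and with it the larger set
    \<open>R\<close>, so that both infima are genuine.\<close>
  then have "r \<in> X" by (auto simp: X_def intro!: exI[of _ "{0}"])
  have bdd: "bdd_below X" "bdd_below R" by (auto simp: X_def R_def intro!: bdd_belowI[of _ 0])
  have "Inf X \<le> Inf R"
  proof (rule cInf_greatest)
    show "R \<noteq> {}" using \<open>r \<in> X\<close> XR by blast
    fix \<delta> assume "\<delta> \<in> R"
    then obtain u where u: "0 < \<delta>" "0 \<le> u"
      "A \<subseteq> {a + \<delta> *\<^sub>R b | a b. a \<in> order_interval u \<and> b \<in> cball 0 1}" by (auto simp: R_def)
    show "Inf X \<le> \<delta>"
    \<comment> \<open>The covering lemma enlarges the radius by an arbitrary \<eta> > 0, which the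
      infimum absorbs.\<close>
    proof (rule field_le_epsilon)
      fix \<eta> :: real assume "0 < \<eta>"
      then have "\<delta> + \<eta> \<in> X"
        using rho_cover_imp_chi_cover[OF assms(2) u(1) _ u(2,3)] u(1) by (simp add: X_def)
      then show "Inf X \<le> \<delta> + \<eta>" using bdd by (intro cInf_lower)
    qed
  qed
  moreover have "Inf R \<le> Inf X" using \<open>r \<in> X\<close> XR bdd by (intro cInf_superset_mono) auto
  ultimately show ?thesis by (simp add: chi_def rho_def X_def R_def)
qed

end
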